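(* Let $p$ be a prime number and let $L$ be a MUM differential operator of order $n\ge 2$ with coefficients in $\mathbb{Z}_p[[z]]$. Let $y_0=\mathfrak{f}(z)$ and $y_1=\mathfrak{f}(z)\log z+\mathfrak{g}(z)$ be the solutions of $L$ with $\mathfrak{f}(z)\in 1+z\mathbb{Q}_p[[z]]$ and $\mathfrak{g}(z)\in z\mathbb{Q}_p[[z]]$. Suppose that $L$ has a $p$-integral Frobenius structure given by the matrix $\Phi=(\phi_{i,j})_{1\leq i,j\leq n}$. If $|\phi_{1,1}(0)|=1$ then $\exp(y_1/y_0)^p\in\mathbb{Z}_p[[z]]$.
   Context: Let $\delta=z\frac{d}{dz}$; $|\cdot|$ is the $p$-adic norm. A monic operator $L=\delta^n+a_{n-1}(z)\delta^{n-1}+\cdots+a_0(z)$ with $a_i\in\mathbb{Q}_p[[z]]$ is MUM if all $a_i\in z\mathbb{Q}_p[[z]]$. For MUM $L$ of order $n\ge2$ there are unique $\mathfrak{f}\in 1+z\mathbb{Q}_p[[z]]$, $\mathfrak{g}\in z\mathbb{Q}_p[[z]]$ such that $\mathfrak{f}$ and $\mathfrak{f}\log z+\mathfrak{g}$ are solutions of $L$ (with $\log z$ a formal symbol, transcendental over power series, $\delta\log z=1$). By definition $\exp(y_1/y_0):=z\exp(\mathfrak{g}/\mathfrak{f})\in\mathbb{Q}_p[[z]]$. The companion matrix $A(z)$ of $L$ is the $n\times n$ matrix with $1$'s on the superdiagonal, last row $(-a_0,-a_1,\ldots,-a_{n-1})$, zeros elsewhere. A $p$-integral Frobenius structure for $L$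 is a matrix $\Phi\in M_n(\mathbb{Z}_p[[z]])$ with $\det\Phi\neq0$ and $\delta\Phi=A(z)\Phi-p\,\Phi A(z^p)$. *)

theory Defs
  imports
    "HOL-Computational_Algebra.Computational_Algebra"
    "Jordan_Normal_Form.Determinant"
    "Berlekamp_Zassenhaus.Finite_Field"
begin

section \<open>The p-adic integers and the p-adic numbers\<close>

text \<open>
  The prime is carried by a type: \<^typ>\<open>'p\<close> of class \<^class>\<open>prime_card\<close> stands for
  \<^term>\<open>CARD('p)\<close>, as for \<^typ>\<open>'p mod_ring\<close>.  The ring of p-adic integers is the inverse limit
  of the rings of integers modulo powers of p; the entry at index n is the
  representative in [0, p^n) of the residue class modulo p^n.
\<close>

typedef (overloaded) ('p::prime_card) padic_int =
  "{x :: nat \<Rightarrow> int. \<forall>n. x n \<in> {0..<int CARD('p) ^ n} \<and> x (Suc n) mod int CARD('p) ^ n = x n}"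
  morphisms padic_residue Abs_padic_int
  by (rule exI[of _ "\<lambda>_. 0"]) (simp add: prime_card prime_gt_0_nat)

setup_lifting type_definition_padic_int

lemma padic_modulus_pos [simp]: "0 < int CARD('p::prime_card) ^ n"
  by (simp add: prime_card prime_gt_0_nat)

lemma padic_mod_Suc [simp]:
  "(k mod (int CARD('p::prime_card) * int CARD('p) ^ n)) mod int CARD('p) ^ n
     = k mod int CARD('p) ^ n"
  by (simp add: mod_mod_cancel)

lemma padic_residue_mod:
  "padic_residue (x :: 'p::prime_card padic_int) n mod int CARD('p) ^ n = padic_residue x n"
  by transfer (simp add: mod_pos_pos_trivial)

instantiation padic_int :: (prime_card) comm_ring_1
begin

lift_definition zero_padic_int :: "'a padic_int" is "\<lambda>_. 0"
  by simp

lift_definition one_padic_int :: "'a padic_int" is "\<lambda>n. 1 mod int CARD('a) ^ n"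
  by simp

lift_definition plus_padic_int :: "'a padic_int \<Rightarrow> 'a padic_int \<Rightarrow> 'a padic_int"
  is "\<lambda>x y n. (x n + y n) mod int CARD('a) ^ n"
  by simp (metis mod_add_eq)

lift_definition uminus_padic_int :: "'a padic_int \<Rightarrow> 'a padic_int"
  is "\<lambda>x n. (- x n) mod int CARD('a) ^ n"
  by simp (metis mod_minus_eq)

lift_definition minus_padic_int :: "'a padic_int \<Rightarrow> 'a padic_int \<Rightarrow> 'a padic_int"
  is "\<lambda>x y n. (x n - y n) mod int CARD('a) ^ n"
  by simp (metis mod_diff_eq)

lift_definition times_padic_int :: "'a padic_int \<Rightarrow> 'a padic_int \<Rightarrow> 'a padic_int"
  is "\<lambda>x y n. (x n * y n) mod int CARD('a) ^ n"
  by simp (metis mod_mult_eq)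

instance
proof
  fix a b c :: "'a padic_int"
  show "a * b * c = a * (b * c)" by transfer (simp add: mod_simps ac_simps)
  show "a * b = b * a" by transfer (simp add: ac_simps)
  show "1 * a = a" by transfer (auto simp: mod_simps mod_pos_pos_trivial)
  show "a + b + c = a + (b + c)" by transfer (simp add: mod_simps ac_simps)
  show "a + b = b + a" by transfer (simp add: ac_simps)
  show "0 + a = a" by transfer (auto simp: mod_pos_pos_trivial)
  show "- a + a = 0" by transfer (simp add: mod_simps)
  show "a - b = a + - b" by transfer (simp add: mod_simps)
  show "(a + b) * c = a * c + b * c" by transfer (simp add: mod_simps algebra_simps)
  have "CARD('a) \<noteq> Suc 0" using prime_card[where 'a='a] by auto
  then have "1 < int CARD('a)" using prime_card[where 'a='a] prime_gt_1_nat by auto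
  then have "(1::int) mod int CARD('a) ^ Suc 0 \<noteq> 0" by simp
  then show "(0 :: 'a padic_int) \<noteq> 1" by transfer metis
qed

end

lemma padic_residue_mod_le:
  fixes x :: "'p::prime_card padic_int"
  assumes "m \<le> n"
  shows "padic_residue x n mod int CARD('p) ^ m = padic_residue x m"
  using assms
proof (induction n rule: dec_induct)
  case base
  show ?case by (rule padic_residue_mod)
next
  case (step n)
  have "padic_residue x (Suc n) mod int CARD('p) ^ n = padic_residue x n"
    using padic_residue[of x] by simp
  moreover have "int CARD('p) ^ m dvd int CARD('p) ^ n" using step(1) by (rule le_imp_power_dvd)
  ultimately show ?case using step.IH by (metis mod_mod_cancel)
qed

lemma padic_residue_eq_0_iff:
  fixes x :: "'p::prime_card padic_int"
  assumes "m \<le> n"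
  shows "padic_residue x m = 0 \<longleftrightarrow> int CARD('p) ^ m dvd padic_residue x n"
  using padic_residue_mod_le[OF assms, of x] by (simp add: dvd_eq_mod_eq_0)

lemma padic_int_eq_0_iff: "x = 0 \<longleftrightarrow> (\<forall>n. padic_residue x n = 0)"
  by transfer auto

definition padic_int_val :: "'p::prime_card padic_int \<Rightarrow> nat" where
  "padic_int_val x = (LEAST n. padic_residue x (Suc n) \<noteq> 0)"

lemma padic_residue_eq_0_iff_val:
  fixes x :: "'p::prime_card padic_int"
  assumes "x \<noteq> 0"
  shows "padic_residue x n = 0 \<longleftrightarrow> n \<le> padic_int_val x"
proof -
  have zero: "padic_residue x 0 = 0"
    using padic_residue_mod[of x 0] by simp
  from assms obtain k where "padic_residue x k \<noteq> 0" by (auto simp: padic_int_eq_0_iff)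
  then have "\<exists>m. padic_residue x (Suc m) \<noteq> 0" using zero by (metis old.nat.exhaust)
  then have nz: "padic_residue x (Suc (padic_int_val x)) \<noteq> 0"
    unfolding padic_int_val_def by (rule LeastI_ex)
  show ?thesis
  proof
    assume "padic_residue x n = 0"
    show "n \<le> padic_int_val x"
    proof (rule ccontr)
      assume "\<not> n \<le> padic_int_val x"
      then have "padic_residue x (Suc (padic_int_val x)) = padic_residue x n mod int CARD('p) ^ Suc (padic_int_val x)"
        using padic_residue_mod_le[of "Suc (padic_int_val x)" n x] by simp
      with \<open>padic_residue x n = 0\<close> nz show False by simp
    qed
  next
    assume "n \<le> padic_int_val x"
    show "padic_residue x n = 0"
    proof (cases n)
      case 0
      with zero show ?thesis by simp
    next
      case (Suc m)
      with \<open>n \<le> padic_int_val x\<close> have "m < padic_int_val x" by simp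
      then show ?thesis unfolding padic_int_val_def Suc using not_less_Least by blast
    qed
  qed
qed

lemma padic_int_mult_nonzero_val:
  fixes x y :: "'p::prime_card padic_int"
  assumes "x \<noteq> 0" "y \<noteq> 0"
  shows "x * y \<noteq> 0" "padic_int_val (x * y) = padic_int_val x + padic_int_val y"
proof -
  let ?p = "int CARD('p)" and ?v = "padic_int_val x" and ?w = "padic_int_val y"
  let ?N = "Suc (?v + ?w)"
  let ?a = "padic_residue x ?N" and ?b = "padic_residue y ?N"
  have prime: "prime ?p" by (rule prime_card_int)
  have xy: "padic_residue (x * y) n = (padic_residue x n * padic_residue y n) mod ?p ^ n" for n
    by transfer simp
  have dx: "?p ^ m dvd ?a \<longleftrightarrow> m \<le> ?v" if "m \<le> ?N" for m
    using padic_residue_eq_0_iff[OF that] padic_residue_eq_0_iff_val[OF assms(1)] by blast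
  have dy: "?p ^ m dvd ?b \<longleftrightarrow> m \<le> ?w" if "m \<le> ?N" for m
    using padic_residue_eq_0_iff[OF that] padic_residue_eq_0_iff_val[OF assms(2)] by blast
  have "\<not> ?p ^ Suc ?v dvd ?a" "\<not> ?p ^ Suc ?w dvd ?b" using dx[of "Suc ?v"] dy[of "Suc ?w"] by auto
  moreover have nz: "?a \<noteq> 0" "?b \<noteq> 0" using calculation by auto
  ultimately have "multiplicity ?p ?a \<le> ?v" "multiplicity ?p ?b \<le> ?w"
    by (metis multiplicity_dvd' not_less_eq_eq)+
  moreover have "multiplicity ?p (?a * ?b) = multiplicity ?p ?a + multiplicity ?p ?b"
    using prime nz by (simp add: prime_elem_multiplicity_mult_distrib)
  ultimately have "\<not> ?p ^ ?N dvd ?a * ?b"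
    using prime nz by (subst power_dvd_iff_le_multiplicity) auto
  then have N: "padic_residue (x * y) ?N \<noteq> 0" unfolding xy by (simp add: dvd_eq_mod_eq_0)
  then show ne: "x * y \<noteq> 0" by (auto simp: padic_int_eq_0_iff)
  have "?p ^ (?v + ?w) dvd ?a * ?b"
    unfolding power_add using dx[of ?v] dy[of ?w] by (intro mult_dvd_mono) auto
  then have "?p ^ (?v + ?w) dvd padic_residue (x * y) ?N"
    unfolding xy by (metis dvd_mod_iff le_imp_power_dvd lessI less_imp_le_nat)
  then have "padic_residue (x * y) (?v + ?w) = 0" by (subst padic_residue_eq_0_iff[of _ ?N]) auto
  then show "padic_int_val (x * y) = ?v + ?w"
    using N padic_residue_eq_0_iff_val[OF ne] by (metis le_antisym not_less_eq_eq)
qed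

instance padic_int :: (prime_card) idom
  by standard (rule padic_int_mult_nonzero_val(1))

lemma padic_residue_of_nat:
  "padic_residue (of_nat k :: 'p::prime_card padic_int) n = int k mod int CARD('p) ^ n"
proof (induction k)
  case 0
  show ?case by (simp add: zero_padic_int.rep_eq)
next
  case (Suc k)
  then show ?case by (simp add: plus_padic_int.rep_eq one_padic_int.rep_eq mod_simps)
qed

instance padic_int :: (prime_card) ring_char_0
proof
  have "j = k" if "(of_nat j :: 'a padic_int) = of_nat k" for j k
  proof -
    have p: "Suc 0 < CARD('a)" using prime_card[where 'a='a] by (rule prime_gt_Suc_0_nat)
    have "j < CARD('a) ^ (j + k)" "k < CARD('a) ^ (j + k)"
      using power_gt_expt[OF p, of "j + k"] by linarith+
    then have "int j < int CARD('a) ^ (j + k)" "int k < int CARD('a) ^ (j + k)"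
      by (simp_all flip: of_nat_power)
    moreover have "int j mod int CARD('a) ^ (j + k) = int k mod int CARD('a) ^ (j + k)"
      using that by (metis padic_residue_of_nat)
    ultimately show "j = k" by simp
  qed
  then show "inj (of_nat :: nat \<Rightarrow> 'a padic_int)" by (rule injI)
qed

instance fract :: ("{idom, ring_char_0}") field_char_0
proof
  show "inj (of_nat :: nat \<Rightarrow> 'a fract)" by (rule injI) (simp add: of_nat_fract eq_fract)
qed

type_synonym 'p padic = "'p padic_int fract"

definition padic_ints :: "'p::prime_card padic set" where
  "padic_ints = range (\<lambda>x. Fract x 1)"

definition padic_int_norm :: "'p::prime_card padic_int \<Rightarrow> real" where
  "padic_int_norm x = (if x = 0 then 0 else (1 / real CARD('p)) ^ padic_int_val x)"

lemma padic_int_norm_mult: "padic_int_norm (x * y) = padic_int_norm x * padic_int_norm y"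
  by (auto simp: padic_int_norm_def padic_int_mult_nonzero_val power_add)

lemma padic_int_norm_eq_0_iff [simp]: "padic_int_norm x = 0 \<longleftrightarrow> x = 0"
  by (auto simp: padic_int_norm_def)

definition padic_norm :: "'p::prime_card padic \<Rightarrow> real" where
  "padic_norm x = (THE r. \<exists>a b. b \<noteq> 0 \<and> x = Fract a b \<and> r = padic_int_norm a / padic_int_norm b)"

lemma padic_norm_Fract:
  fixes a b :: "'p::prime_card padic_int"
  assumes "b \<noteq> 0"
  shows "padic_norm (Fract a b) = padic_int_norm a / padic_int_norm b"
  unfolding padic_norm_def
proof (rule the_equality)
  fix r assume "\<exists>c d. d \<noteq> 0 \<and> Fract a b = Fract c d \<and> r = padic_int_norm c / padic_int_norm d"
  then obtain c d where cd: "d \<noteq> 0" "a * d = c * b" "r = padic_int_norm c / padic_int_norm d"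
    using assms by (auto simp: eq_fract)
  then have "padic_int_norm a * padic_int_norm d = padic_int_norm c * padic_int_norm b"
    by (metis padic_int_norm_mult)
  with assms cd show "r = padic_int_norm a / padic_int_norm b" by (simp add: frac_eq_eq)
qed (use assms in blast)

lemma padic_norm_mult: "padic_norm (x * y) = padic_norm x * padic_norm y"
  by (cases x, cases y) (simp add: padic_norm_Fract padic_int_norm_mult)

lemma padic_norm_CARD: "padic_norm (of_nat CARD('p) :: 'p::prime_card padic) = 1 / real CARD('p)"
proof -
  let ?p = "of_nat CARD('p) :: 'p padic_int"
  have p: "1 < CARD('p)" using prime_card[where 'a='p] by (rule prime_gt_1_nat)
  then have ne: "?p \<noteq> 0" unfolding of_nat_eq_0_iff by linarith
  have "padic_residue ?p 1 = 0" by (simp add: padic_residue_of_nat)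
  moreover have "padic_residue ?p 2 \<noteq> 0"
    using p by (simp add: padic_residue_of_nat power2_eq_square)
  ultimately have "padic_int_val ?p = 1" using padic_residue_eq_0_iff_val[OF ne] by fastforce
  moreover have "(1 :: 'p padic_int) \<noteq> 0" by simp
  then have "padic_int_val (1 :: 'p padic_int) = 0"
    using padic_int_mult_nonzero_val(2)[of "1 :: 'p padic_int" 1] by simp
  ultimately show ?thesis using ne
    by (simp add: of_nat_fract padic_norm_Fract padic_int_norm_def)
qed

definition padic_integral_fps :: "'p::prime_card padic fps \<Rightarrow> bool" where
  "padic_integral_fps F \<longleftrightarrow> (\<forall>k. fps_nth F k \<in> padic_ints)"


section \<open>Differential operators in \<delta> = z d/dz\<close>

text \<open>
  A monic operator of order n is given by its coefficients \<^term>\<open>a i\<close> for \<^term>\<open>i < n\<close>; values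
  of \<^term>\<open>a\<close> at other arguments are irrelevant.  The derivation \<delta> on power series is
  \<^const>\<open>fps_XD\<close>.
\<close>

definition MUM :: "nat \<Rightarrow> (nat \<Rightarrow> 'a::comm_ring_1 fps) \<Rightarrow> bool" where
  "MUM n a \<longleftrightarrow> (\<forall>i<n. fps_nth (a i) 0 = 0)"

text \<open>
  Expressions in the formal symbol log z are polynomials over the power series ring, the
  polynomial variable being log z.  Since \<delta> (log z) = 1, \<delta> acts as \<^const>\<open>fps_XD\<close> on
  coefficients plus \<^const>\<open>pderiv\<close>.
\<close>

definition log_z :: "'a::idom fps poly" where
  "log_z = [:0, 1:]"

definition log_delta :: "'a::idom fps poly \<Rightarrow> 'a fps poly" where
  "log_delta Y = map_poly fps_XD Y + pderiv Y"

definition diff_op :: "nat \<Rightarrow> (nat \<Rightarrow> 'a::idom fps) \<Rightarrow> 'a fps poly \<Rightarrow> 'a fps poly" where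
  "diff_op n a Y = (log_delta ^^ n) Y + (\<Sum>i<n. Polynomial.smult (a i) ((log_delta ^^ i) Y))"

text \<open>The series exp(y1/y0) = z exp(g/f) attached to y0 = f and y1 = f log z + g.\<close>

definition exp_quotient :: "'a::field_char_0 fps \<Rightarrow> 'a fps \<Rightarrow> 'a fps" where
  "exp_quotient f g = fps_X * fps_compose (fps_exp 1) (g / f)"


section \<open>Frobenius structures\<close>

text \<open>Matrix indices start at 0.\<close>

definition companion_mat :: "nat \<Rightarrow> (nat \<Rightarrow> 'a::comm_ring_1 fps) \<Rightarrow> 'a fps mat" where
  "companion_mat n a = mat n n (\<lambda>(i, j).
     if i = n - 1 then - a j else if j = i + 1 then 1 else 0)"

definition p_integral_Frobenius_structure ::
  "nat \<Rightarrow> (nat \<Rightarrow> 'p::prime_card padic fps) \<Rightarrow> 'p padic fps mat \<Rightarrow> bool" where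
  "p_integral_Frobenius_structure n a \<Phi> \<longleftrightarrow>
     \<Phi> \<in> carrier_mat n n \<and>
     (\<forall>i<n. \<forall>j<n. padic_integral_fps (\<Phi> $$ (i, j))) \<and>
     det \<Phi> \<noteq> 0 \<and>
     map_mat fps_XD \<Phi> =
       companion_mat n a * \<Phi>
       - of_nat CARD('p) \<cdot>\<^sub>m
           (\<Phi> * map_mat (\<lambda>F. fps_compose F (fps_X ^ CARD('p))) (companion_mat n a))"

end

theory Submission
  imports Defs "HOL-Number_Theory.Residues" "HOL-Number_Theory.Modular_Inverse"
begin

text \<open>
  Write F(z)^\<sigma> for F(z^p), u_i = \<delta>^i f, t = g/f, \<tau> = log z + t = y_1/y_0, w = \<delta>\<tau> and
  c = \<phi>_00(0), a p-adic unit (indices start at 0).  The Frobenius matrix maps solutions at z^p to solutions at z.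
  Applied to f it gives \<Phi> u^\<sigma> = c u, a recursion which makes f integral.  Applied to
  f \<tau>, and after subtracting \<tau>^\<sigma> \<Phi> u^\<sigma>, it gives
  \<Sum>_j \<phi>_ij e_j^\<sigma> = p c e_i + (c (p t - t^\<sigma>) + \<beta>) u_i, where e_i = \<delta>^i (f \<tau>) - \<tau> \<delta>^i f is a
  combination of derivatives of w.

  Modulo p the columns of \<Phi> are solution vectors of L, hence proportional to u over
  series in z^p, because a MUM operator has no solution modulo p whose leading exponent is
  prime to p.  Therefore f \<phi>_1j - (\<delta>f) \<phi>_0j is divisible by p, and eliminating t from the
  relations for i = 0, 1 leaves an integral recursion for w.  The relation for i = 0
  then shows that t^\<sigma> - p t is integral, and Dwork's lemma gives exp(p t) integral.
\<close>

section \<open>Dwork's lemma\<close>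

text \<open>Both sides solve Z' = (A + B)' Z with constant term 1, so their quotient has derivative
  0 and equals 1.\<close>

lemma fps_compose_exp_add:
  fixes A B :: "'a::field_char_0 fps"
  assumes "fps_nth A 0 = 0" "fps_nth B 0 = 0"
  shows "fps_exp 1 oo (A + B) = (fps_exp 1 oo A) * (fps_exp 1 oo B)"
proof -
  define Z where "Z = fps_exp 1 oo (A + B)"
  define Y where "Y = (fps_exp 1 oo A) * (fps_exp 1 oo B)"
  have Z0: "fps_nth Z 0 = 1" and Y0: "fps_nth Y 0 = 1" by (simp_all add: Z_def Y_def)
  have dZ: "fps_deriv Z = fps_deriv (A + B) * Z"
    using assms by (simp add: Z_def fps_compose_deriv)
  have dY: "fps_deriv Y = fps_deriv (A + B) * Y"
    using assms by (simp add: Y_def fps_compose_deriv algebra_simps)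
  have ZiZ: "Z * inverse Z = 1" using Z0 by (simp add: inverse_mult_eq_1')
  have "fps_deriv (Y * inverse Z) = fps_deriv (A + B) * Y * inverse Z * (1 - Z * inverse Z)"
    using Z0 by (simp add: fps_inverse_deriv dZ dY algebra_simps power2_eq_square)
  then have "fps_deriv (Y * inverse Z) = 0" by (simp add: ZiZ)
  then have "Y * inverse Z = fps_const (fps_nth (Y * inverse Z) 0)" by (simp only: fps_deriv_eq_0_iff)
  also have "fps_nth (Y * inverse Z) 0 = 1" using Z0 Y0 by simp
  finally have "Y * (Z * inverse Z) = Z" by (metis ab_semigroup_mult_class.mult_ac(1) fps_const_1_eq_1 mult.commute mult_1)
  then show ?thesis unfolding ZiZ by (simp add: Y_def Z_def)
qed

lemma fps_compose_exp_of_nat_mult: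
  fixes A :: "'a::field_char_0 fps"
  assumes "fps_nth A 0 = 0"
  shows "fps_exp 1 oo (of_nat k * A) = (fps_exp 1 oo A) ^ k"
proof (induction k)
  case 0
  show ?case by simp
next
  case (Suc k)
  have "fps_exp 1 oo (of_nat (Suc k) * A) = fps_exp 1 oo (A + of_nat k * A)"
    by (simp add: algebra_simps)
  also have "\<dots> = (fps_exp 1 oo A) * (fps_exp 1 oo (of_nat k * A))"
    using assms by (intro fps_compose_exp_add) auto
  finally show ?case by (simp add: Suc.IH)
qed

text \<open>Among the factors 1, ..., p k + r only p, 2 p, ..., k p are divisible by p. They
  contribute p^k k!, and the other factors make up u.\<close>

lemma fact_prime_block:
  assumes "prime (p::nat)" "r < p"
  shows "\<exists>u. fact (p * k + r) = p ^ k * fact k * u \<and> \<not> p dvd u"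
  using assms(2)
proof (induction k arbitrary: r)
  case 0
  show ?case using assms(1) 0 by (auto simp: prime_dvd_fact_iff)
next
  case (Suc k)
  show ?case using Suc.prems
  proof (induction r)
    case 0
    have "p > 0" using assms(1) by (rule prime_gt_0_nat)
    then obtain q where q: "p = Suc q" by (cases p) auto
    obtain u where u: "fact (p * k + q) = p ^ k * fact k * u" "\<not> p dvd u"
      using Suc.IH[of q] q by auto
    have "p * Suc k + 0 = Suc (p * k + q)" using q by simp
    then have "fact (p * Suc k + 0) = p * Suc k * fact (p * k + q)"
      by (metis add_0_right fact_Suc of_nat_id)
    also have "\<dots> = p ^ Suc k * fact (Suc k) * u" unfolding u(1) by (simp add: algebra_simps)
    finally show ?case using u(2) by blast
  next
    case (Suc r)
    then obtain u where u: "fact (p * Suc k + r) = p ^ Suc k * fact (Suc k) * u" "\<not> p dvd u" by auto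
    have "\<not> p dvd Suc r" using Suc.prems by (auto dest: dvd_imp_le)
    then have "\<not> p dvd p * Suc k + Suc r" by (metis dvd_add_right_iff dvd_triv_left)
    then have "\<not> p dvd (p * Suc k + Suc r) * u" using u(2) assms(1) prime_dvd_mult_iff by blast
    moreover have "fact (p * Suc k + Suc r) = p ^ Suc k * fact (Suc k) * ((p * Suc k + Suc r) * u)"
      using u(1) by (simp only: add_Suc_right fact_Suc of_nat_id) (simp only: mult_ac)
    ultimately show ?case by blast
  qed
qed

text \<open>This is the factorisation of x^k - y^k, where F and its truncation differ by z^m times a
  series. It controls F^k below degree m and in degree m.\<close>

lemma fps_power_diff_cutoff:
  fixes F :: "'b::comm_ring_1 fps"
  shows "F ^ k - fps_cutoff m F ^ k
    = fps_X ^ m * (fps_shift m F * (\<Sum>i<k. fps_cutoff m F ^ (k - Suc i) * F ^ i))"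
proof -
  have "F - fps_cutoff m F = fps_X ^ m * fps_shift m F"
    by (auto simp: fps_eq_iff fps_X_power_mult_nth)
  then show ?thesis by (simp add: power_diff_sumr2 mult_ac)
qed

lemma fps_power_nth_cutoff:
  fixes F :: "'b::comm_ring_1 fps"
  assumes "i < m"
  shows "fps_nth (fps_cutoff m F ^ k) i = fps_nth (F ^ k) i"
  using arg_cong[OF fps_power_diff_cutoff[of F k m], of "\<lambda>G. fps_nth G i"] assms
  by (simp add: fps_X_power_mult_nth)

text \<open>In degree m of F^k the m-th coefficient of F enters linearly, with factor k because F(0)
  = 1. For k = p this isolates the unknown coefficient in Dwork's lemma.\<close>

lemma fps_power_nth_leading:
  fixes F :: "'b::comm_ring_1 fps"
  assumes "fps_nth F 0 = 1" "m > 0"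
  shows "fps_nth (F ^ k) m = fps_nth (fps_cutoff m F ^ k) m + of_nat k * fps_nth F m"
proof -
  have "fps_nth (F ^ k - fps_cutoff m F ^ k) m
      = fps_nth (fps_shift m F * (\<Sum>i<k. fps_cutoff m F ^ (k - Suc i) * F ^ i)) 0"
    unfolding fps_power_diff_cutoff by (simp only: fps_X_power_mult_nth) simp
  also have "\<dots> = of_nat k * fps_nth F m"
    using assms by (simp add: fps_sum_nth fps_power_zeroth)
  finally show ?thesis by (simp add: algebra_simps)
qed

section \<open>Integrality and divisibility by p, coefficient by coefficient\<close>

definition fps_with_coeffs :: "'a set \<Rightarrow> 'a fps set" where
  "fps_with_coeffs S = {F. \<forall>k. fps_nth F k \<in> S}"

lemma fps_with_coeffsI: "(\<And>k. fps_nth F k \<in> S) \<Longrightarrow> F \<in> fps_with_coeffs S"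
  by (simp add: fps_with_coeffs_def)

lemma fps_with_coeffsD: "F \<in> fps_with_coeffs S \<Longrightarrow> fps_nth F k \<in> S"
  by (simp add: fps_with_coeffs_def)

text \<open>Abstracts the p-adic integers inside the field of p-adic numbers.\<close>

locale p_local_subring =
  fixes R :: "'a::field_char_0 set" and p :: nat
  assumes prime_p: "prime p"
    and one_mem: "1 \<in> R"
    and diff_mem: "x \<in> R \<Longrightarrow> y \<in> R \<Longrightarrow> x - y \<in> R"
    and mult_mem: "x \<in> R \<Longrightarrow> y \<in> R \<Longrightarrow> x * y \<in> R"
    and inverse_of_nat_mem: "\<not> p dvd m \<Longrightarrow> inverse (of_nat m) \<in> R"
    and fermat: "x \<in> R \<Longrightarrow> (x ^ p - x) / of_nat p \<in> R"
begin

definition pR :: "'a set" where "pR = {x. x / of_nat p \<in> R}"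

abbreviation "RS \<equiv> fps_with_coeffs R"
abbreviation "pRS \<equiv> fps_with_coeffs pR"

lemma p_pos: "p > 0"
  using prime_p by (rule prime_gt_0_nat)

lemma p_nonzero [simp]: "p \<noteq> 0"
  using p_pos by simp

lemma zero_mem: "0 \<in> R"
  using diff_mem[OF one_mem one_mem] by simp

lemma add_mem: "x \<in> R \<Longrightarrow> y \<in> R \<Longrightarrow> x + y \<in> R"
  using diff_mem[OF _ diff_mem[OF zero_mem, of y]] by fastforce

lemma uminus_mem: "x \<in> R \<Longrightarrow> - x \<in> R"
  using diff_mem[OF zero_mem] by fastforce

lemma of_nat_mem: "of_nat m \<in> R"
  by (induction m) (auto intro: zero_mem one_mem add_mem)

lemma power_mem: "x \<in> R \<Longrightarrow> x ^ m \<in> R"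
  by (induction m) (auto intro: one_mem mult_mem)

lemma sum_mem: "(\<And>i. i \<in> I \<Longrightarrow> f i \<in> R) \<Longrightarrow> sum f I \<in> R"
  by (induction I rule: infinite_finite_induct) (auto intro: zero_mem add_mem)

lemmas R_intros = zero_mem one_mem add_mem diff_mem uminus_mem mult_mem of_nat_mem power_mem sum_mem

lemma pR_p_mult: "x \<in> R \<Longrightarrow> of_nat p * x \<in> pR"
  by (simp add: pR_def)

lemma pR_zero: "0 \<in> pR"
  by (simp add: pR_def zero_mem)

lemma pR_add: "x \<in> pR \<Longrightarrow> y \<in> pR \<Longrightarrow> x + y \<in> pR"
  by (simp add: pR_def add_divide_distrib add_mem)

lemma pR_diff: "x \<in> pR \<Longrightarrow> y \<in> pR \<Longrightarrow> x - y \<in> pR"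
  by (simp add: pR_def diff_divide_distrib diff_mem)

lemma pR_mult: "x \<in> R \<Longrightarrow> y \<in> pR \<Longrightarrow> x * y \<in> pR"
  using mult_mem by (fastforce simp: pR_def)

lemma pR_sum: "(\<And>i. i \<in> I \<Longrightarrow> f i \<in> pR) \<Longrightarrow> sum f I \<in> pR"
  by (induction I rule: infinite_finite_induct) (auto intro: pR_zero pR_add)

lemma RS_zero: "0 \<in> RS" and RS_one: "1 \<in> RS"
  by (auto intro!: fps_with_coeffsI intro: R_intros)

lemma RS_const: "x \<in> R \<Longrightarrow> fps_const x \<in> RS"
  by (auto intro!: fps_with_coeffsI intro: R_intros)

lemma RS_add: "F \<in> RS \<Longrightarrow> G \<in> RS \<Longrightarrow> F + G \<in> RS"
  and RS_diff: "F \<in> RS \<Longrightarrow> G \<in> RS \<Longrightarrow> F - G \<in> RS"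
  and RS_uminus: "F \<in> RS \<Longrightarrow> - F \<in> RS"
  by (auto intro!: fps_with_coeffsI simp: R_intros fps_with_coeffsD)

lemma RS_mult: "F \<in> RS \<Longrightarrow> G \<in> RS \<Longrightarrow> F * G \<in> RS"
  by (auto intro!: fps_with_coeffsI sum_mem mult_mem simp: fps_mult_nth intro: fps_with_coeffsD)

lemma RS_power: "F \<in> RS \<Longrightarrow> F ^ m \<in> RS"
  by (induction m) (auto intro: RS_one RS_mult)

lemma RS_sum: "(\<And>i. i \<in> I \<Longrightarrow> F i \<in> RS) \<Longrightarrow> sum F I \<in> RS"
  by (induction I rule: infinite_finite_induct) (auto intro: RS_zero RS_add)

lemma RS_XD: "F \<in> RS \<Longrightarrow> fps_XD F \<in> RS"
  by (auto intro!: fps_with_coeffsI simp: R_intros fps_with_coeffsD)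

lemma RS_XD_pow: "F \<in> RS \<Longrightarrow> (fps_XD ^^ i) F \<in> RS"
  by (induction i) (auto intro: RS_XD)

lemma RS_compose_power: "F \<in> RS \<Longrightarrow> F oo fps_X ^ p \<in> RS"
  by (auto intro!: fps_with_coeffsI simp: fps_nth_compose_X_power zero_mem intro: fps_with_coeffsD)

lemma RS_inverse:
  assumes "F \<in> RS" "fps_nth F 0 = 1"
  shows "inverse F \<in> RS"
proof (rule fps_with_coeffsI)
  fix k
  show "fps_nth (inverse F) k \<in> R"
  proof (induction k rule: less_induct)
    case (less k)
    show ?case
    proof (cases "k = 0")
      case True
      then show ?thesis using assms by (simp add: one_mem)
    next
      case False
      have "0 = fps_nth (F * inverse F) k"
        using assms(2) False by (simp add: inverse_mult_eq_1')
      also have "\<dots> = fps_nth (inverse F) k + (\<Sum>i=1..k. fps_nth F i * fps_nth (inverse F) (k - i))"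
        using assms(2) by (simp add: fps_mult_nth sum.atLeast_Suc_atMost)
      finally have "fps_nth (inverse F) k = - (\<Sum>i=1..k. fps_nth F i * fps_nth (inverse F) (k - i))"
        by (simp add: eq_neg_iff_add_eq_0)
      also have "\<dots> \<in> R"
        by (intro uminus_mem sum_mem mult_mem less.IH) (auto intro: fps_with_coeffsD[OF assms(1)])
      finally show ?thesis .
    qed
  qed
qed

lemma pRS_zero: "0 \<in> pRS"
  by (auto intro!: fps_with_coeffsI intro: pR_zero)

lemma pRS_add: "F \<in> pRS \<Longrightarrow> G \<in> pRS \<Longrightarrow> F + G \<in> pRS"
  and pRS_diff: "F \<in> pRS \<Longrightarrow> G \<in> pRS \<Longrightarrow> F - G \<in> pRS"
  by (auto intro!: fps_with_coeffsI simp: pR_add pR_diff fps_with_coeffsD)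

lemma pRS_mult: "F \<in> RS \<Longrightarrow> G \<in> pRS \<Longrightarrow> F * G \<in> pRS"
  by (auto intro!: fps_with_coeffsI pR_sum pR_mult simp: fps_mult_nth intro: fps_with_coeffsD)

lemma pRS_sum: "(\<And>i. i \<in> I \<Longrightarrow> F i \<in> pRS) \<Longrightarrow> sum F I \<in> pRS"
  by (induction I rule: infinite_finite_induct) (auto intro: pRS_zero pRS_add)

lemma pRS_XD: "F \<in> pRS \<Longrightarrow> fps_XD F \<in> pRS"
  by (auto intro!: fps_with_coeffsI simp: pR_mult of_nat_mem fps_with_coeffsD)

lemma pRS_p_mult: "F \<in> RS \<Longrightarrow> of_nat p * F \<in> pRS"
  by (auto intro!: fps_with_coeffsI simp: fps_of_nat[symmetric] pR_p_mult fps_with_coeffsD)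

lemma pRS_iff: "F \<in> pRS \<longleftrightarrow> (\<exists>G\<in>RS. F = of_nat p * G)"
proof
  assume "F \<in> pRS"
  then have "fps_const (inverse (of_nat p)) * F \<in> RS"
    by (auto simp: fps_with_coeffs_def pR_def field_simps)
  moreover have "F = of_nat p * (fps_const (inverse (of_nat p)) * F)"
    by (simp add: fps_of_nat[symmetric] fps_eq_iff)
  ultimately show "\<exists>G\<in>RS. F = of_nat p * G" by blast
qed (auto intro: pRS_p_mult)

text \<open>If p divides m, the conclusion is immediate; otherwise m is a unit and can be divided
  out. This turns the indicial term m^n of a MUM operator into a statement about \<delta> of a
  series.\<close>

lemma pR_cancel_nat_power:
  assumes "of_nat m ^ n * x \<in> pR" "x \<in> R"
  shows "of_nat m * x \<in> pR"
proof (cases "p dvd m")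
  case True
  then obtain k where "m = p * k" ..
  then show ?thesis using pR_p_mult[OF mult_mem[OF of_nat_mem[of k] assms(2)]] by (simp add: mult_ac)
next
  case False
  then have "m \<noteq> 0" by (metis dvd_0_right)
  then have "x = inverse (of_nat m) ^ n * (of_nat m ^ n * x)" by (simp add: field_simps)
  also have "\<dots> \<in> pR" by (intro pR_mult power_mem inverse_of_nat_mem False assms)
  finally show ?thesis by (intro pR_mult of_nat_mem)
qed

text \<open>The p-adic valuation of i! is less than i for i > 0. The induction descends from i to i
  div p through \<open>fact_prime_block\<close>.\<close>

lemma p_power_div_fact_mem:
  assumes "i > 0"
  shows "of_nat p ^ i / fact i \<in> pR"
  using assms
proof (induction i rule: less_induct)
  case (less i)
  define k r where "k = i div p" and "r = i mod p"
  have i: "i = p * k + r" and r: "r < p" using p_pos by (simp_all add: k_def r_def)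
  obtain u where u: "fact i = p ^ k * fact k * u" "\<not> p dvd u"
    using fact_prime_block[OF prime_p r, of k] unfolding i by blast
  have "(fact i :: 'a) = of_nat (fact i)" by simp
  also have "\<dots> = of_nat p ^ k * fact k * of_nat u" unfolding u(1) by simp
  finally have fact_i: "(fact i :: 'a) = of_nat p ^ k * fact k * of_nat u" .
  have u0: "(of_nat u :: 'a) \<noteq> 0" using u(2) by (metis dvd_0_right of_nat_eq_0_iff)
  show ?case
  proof (cases "k = 0")
    case True
    obtain j where j: "i = Suc j" using less.prems by (cases i) auto
    have "of_nat p ^ i / fact i = of_nat p * (of_nat p ^ j * inverse (of_nat u) :: 'a)"
      unfolding fact_i unfolding True j by (simp add: field_simps)
    also have "\<dots> \<in> pR" by (intro pR_p_mult mult_mem power_mem of_nat_mem inverse_of_nat_mem u)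
    finally show ?thesis .
  next
    case False
    \<comment> \<open>As 2 k \<le> i, the power p^i contains p^k twice: one copy cancels against i!,
      the other stays with k! for the induction hypothesis.\<close>
    have "2 * k \<le> p * k" using prime_ge_2_nat[OF prime_p] by (rule mult_le_mono1)
    then have "i = k + k + (i - 2 * k)" using i by linarith
    then have "(of_nat p :: 'a) ^ i = of_nat p ^ k * of_nat p ^ k * of_nat p ^ (i - 2 * k)"
      by (metis power_add)
    then have "of_nat p ^ i / fact i
        = (of_nat p ^ (i - 2 * k) * inverse (of_nat u)) * (of_nat p ^ k / fact k :: 'a)"
      using u0 by (simp add: fact_i field_simps)
    also have "\<dots> \<in> pR"
    proof (intro pR_mult mult_mem power_mem of_nat_mem inverse_of_nat_mem u less.IH)
      show "k < i" using less.prems prime_gt_1_nat[OF prime_p] by (simp add: k_def)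
    qed (use False in simp)
    finally show ?thesis .
  qed
qed

text \<open>Apart from the constant 1, exp(p S) is a sum of terms (p^i / i!) S^i with i > 0, whose
  scalar factors are divisible by p.\<close>

lemma exp_p_compose_cong_1:
  assumes "S \<in> RS" "fps_nth S 0 = 0"
  shows "(fps_exp (of_nat p) oo S) - 1 \<in> pRS"
proof (rule fps_with_coeffsI)
  fix m
  show "fps_nth ((fps_exp (of_nat p) oo S) - 1) m \<in> pR"
  proof (cases "m = 0")
    case True
    then show ?thesis by (simp add: pR_zero)
  next
    case False
    have "fps_nth ((fps_exp (of_nat p) oo S) - 1) m
        = (\<Sum>i=0..m. of_nat p ^ i / fact i * fps_nth (S ^ i) m)"
      using False by (simp add: fps_compose_nth)
    also have "\<dots> \<in> pR"
    proof (rule pR_sum)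
      fix i
      show "of_nat p ^ i / fact i * fps_nth (S ^ i) m \<in> pR"
      proof (cases "i = 0")
        case True
        then show ?thesis using False by (simp add: pR_zero)
      next
        case i: False
        have "fps_nth (S ^ i) m \<in> R" using RS_power[OF assms(1)] by (rule fps_with_coeffsD)
        then show ?thesis using pR_mult p_power_div_fact_mem[of i] i by (metis mult.commute neq0_conv)
      qed
    qed
    finally show ?thesis .
  qed
qed

section \<open>The Frobenius congruence: p-th powers modulo p\<close>

lemma add_power_p_cong:
  assumes "F \<in> RS" "G \<in> RS"
  shows "(F + G) ^ p - (F ^ p + G ^ p) \<in> pRS"
proof -
  let ?t = "\<lambda>k. of_nat (p choose k) * F ^ k * G ^ (p - k)"
  obtain q where q: "p = Suc q" using p_pos by (cases p) auto
  have "(F + G) ^ p = sum ?t {0..p}" by (simp add: binomial_ring atMost_atLeast0)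
  also have "\<dots> = ?t 0 + sum ?t {1..p}" by (simp add: sum.atLeast_Suc_atMost)
  also have "sum ?t {1..p} = sum ?t {1..q} + ?t p" by (simp add: q)
  finally have "(F + G) ^ p - (F ^ p + G ^ p) = sum ?t {1..q}" by simp
  also have "\<dots> \<in> pRS"
  proof (rule pRS_sum)
    fix k assume "k \<in> {1..q}"
    then have "p dvd (p choose k)" using prime_p q by (intro dvd_choose_prime) auto
    then obtain l where l: "p choose k = p * l" ..
    have "of_nat l * F ^ k * G ^ (p - k) \<in> RS"
      unfolding fps_of_nat[symmetric] by (intro RS_mult RS_const RS_power of_nat_mem assms)
    then show "?t k \<in> pRS" using pRS_p_mult by (fastforce simp: l mult.assoc)
  qed
  finally show ?thesis .
qed

text \<open>Monomials are added one at a time, with \<open>add_power_p_cong\<close> for the sum and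
  \<open>fermat\<close> for the coefficient. Truncation keeps the hypothesis within what an
  induction on the degree provides.\<close>

lemma frobenius_fps_cutoff_cong:
  assumes "\<And>k. k < m \<Longrightarrow> fps_nth F k \<in> R"
  shows "fps_cutoff m F ^ p - (fps_cutoff m F oo fps_X ^ p) \<in> pRS"
  using assms
proof (induction m)
  case 0
  then show ?case using p_pos by (simp add: pRS_zero power_0_left)
next
  case (Suc m)
  define T where "T = fps_const (fps_nth F m) * fps_X ^ m"
  have cut: "fps_cutoff (Suc m) F = fps_cutoff m F + T"
    by (auto simp: T_def fps_eq_iff less_Suc_eq)
  have x: "fps_nth F m \<in> R" using Suc.prems by simp
  have C: "fps_cutoff m F \<in> RS"
    using Suc.prems by (auto intro!: fps_with_coeffsI zero_mem)
  have T: "T \<in> RS" unfolding T_def using x by (auto intro!: fps_with_coeffsI zero_mem)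
  have TT: "T ^ p - (T oo fps_X ^ p) \<in> pRS"
  proof -
    have "T oo fps_X ^ p = fps_const (fps_nth F m) * fps_X ^ (m * p)"
    proof -
      have X0: "fps_nth (fps_X ^ p :: 'a fps) 0 = 0" using p_pos by simp
      have "(fps_X ^ m oo fps_X ^ p :: 'a fps) = (fps_X oo fps_X ^ p) ^ m"
        by (rule fps_compose_power[OF X0, symmetric])
      also have "\<dots> = (fps_X ^ p) ^ m" by (simp only: fps_X_fps_compose_startby0[OF X0])
      also have "\<dots> = fps_X ^ (m * p)" by (metis power_mult mult.commute)
      finally show ?thesis
        by (simp only: T_def fps_compose_mult_distrib[OF X0] fps_const_compose)
    qed
    moreover have "T ^ p = fps_const (fps_nth F m ^ p) * fps_X ^ (m * p)"
      by (simp add: T_def power_mult_distrib power_mult fps_const_power)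
    ultimately have "T ^ p - (T oo fps_X ^ p) = fps_const (fps_nth F m ^ p - fps_nth F m) * fps_X ^ (m * p)"
      by (simp add: algebra_simps flip: fps_const_sub)
    also have "\<dots> \<in> pRS" using fermat[OF x] by (auto intro!: fps_with_coeffsI pR_zero simp: pR_def zero_mem)
    finally show ?thesis .
  qed
  have "fps_cutoff (Suc m) F ^ p - (fps_cutoff (Suc m) F oo fps_X ^ p)
    = ((fps_cutoff m F + T) ^ p - (fps_cutoff m F ^ p + T ^ p))
      + (fps_cutoff m F ^ p - (fps_cutoff m F oo fps_X ^ p)) + (T ^ p - (T oo fps_X ^ p))"
    unfolding cut fps_compose_add_distrib by simp
  also have "\<dots> \<in> pRS" by (intro pRS_add add_power_p_cong C T TT Suc.IH) (use Suc.prems in simp)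
  finally show ?case .
qed


text \<open>Put E = exp T, Q = E^p and S = T(z^p) - p T. Then E(z^p) = Q exp S, and p-th powers give
  Q(z^p) = Q^p exp(p S), where exp(p S) is 1 modulo p. Comparing coefficients in degree m puts p
  times the coefficient of Q into p R, by induction.\<close>

theorem dwork_exp_mem:
  fixes T :: "'a fps"
  assumes T0: "fps_nth T 0 = 0" and S: "(T oo fps_X ^ p) - of_nat p * T \<in> RS"
  shows "(fps_exp 1 oo T) ^ p \<in> RS"
proof -
  define S where "S = (T oo fps_X ^ p) - of_nat p * T"
  define Q where "Q = (fps_exp 1 oo T) ^ p"
  define V where "V = (fps_exp (of_nat p) oo S) - 1"
  have X0: "fps_nth (fps_X ^ p :: 'a fps) 0 = 0" using p_pos by simp
  have S0: "fps_nth S 0 = 0" using T0 by (simp add: S_def)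
  have "S \<in> RS" unfolding S_def by (rule S)
  then have V: "V \<in> pRS" unfolding V_def using S0 by (rule exp_p_compose_cong_1)
  have V0: "fps_nth V 0 = 0" by (simp add: V_def)
  have Q0: "fps_nth Q 0 = 1" by (simp add: Q_def fps_power_zeroth)
  have "(fps_exp 1 oo T) oo fps_X ^ p = fps_exp 1 oo (of_nat p * T + S)"
    unfolding S_def using fps_compose_assoc[OF X0 T0] by simp
  also have "\<dots> = (fps_exp 1 oo (of_nat p * T)) * (fps_exp 1 oo S)"
    using T0 S0 by (intro fps_compose_exp_add) auto
  also have "\<dots> = Q * (fps_exp 1 oo S)"
    unfolding Q_def fps_compose_exp_of_nat_mult[OF T0] ..
  finally have "Q oo fps_X ^ p = (Q * (fps_exp 1 oo S)) ^ p"
    unfolding Q_def fps_compose_power[OF X0, symmetric] by simp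
  also have "\<dots> = Q ^ p * (fps_exp (of_nat p) oo S)"
    by (simp add: power_mult_distrib fps_compose_power[OF S0] fps_exp_power_mult)
  also have "\<dots> = Q ^ p + Q ^ p * V" by (simp add: V_def algebra_simps)
  finally have eq: "Q oo fps_X ^ p = Q ^ p + Q ^ p * V" .
  have "fps_nth Q m \<in> R" for m
  proof (induction m rule: less_induct)
    case (less m)
    show ?case
    proof (cases "m = 0")
      case True
      then show ?thesis by (simp add: Q0 one_mem)
    next
      case False
      define C where "C = fps_cutoff m Q"
      have C: "C \<in> RS" using less.IH by (auto intro!: fps_with_coeffsI zero_mem simp: C_def)
      \<comment> \<open>In degree m > 0 the series Q(z^p) sees only coefficients of Q below m, so
        the truncation \<open>C\<close> may replace Q.\<close>
      have "m div p < m" using False prime_gt_1_nat[OF prime_p] by simp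
      then have "fps_nth (Q oo fps_X ^ p) m = fps_nth (C oo fps_X ^ p) m"
        by (simp add: fps_nth_compose_X_power C_def)
      moreover have "fps_nth (Q ^ p) m = fps_nth (C ^ p) m + of_nat p * fps_nth Q m"
        unfolding C_def using Q0 False by (intro fps_power_nth_leading) auto
      ultimately have "of_nat p * fps_nth Q m
          = - fps_nth (C ^ p - (C oo fps_X ^ p)) m - fps_nth (Q ^ p * V) m"
        using arg_cong[OF eq, of "\<lambda>F. fps_nth F m"] by (simp add: algebra_simps)
      also have "\<dots> \<in> pR"
      proof -
        have 1: "fps_nth (C ^ p - (C oo fps_X ^ p)) m \<in> pR"
          unfolding C_def by (intro fps_with_coeffsD[OF frobenius_fps_cutoff_cong] less.IH)
        have 2: "fps_nth (Q ^ p * V) m \<in> pR"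
          unfolding fps_mult_nth
        proof (rule pR_sum)
          fix i assume "i \<in> {0..m}"
          show "fps_nth (Q ^ p) i * fps_nth V (m - i) \<in> pR"
          \<comment> \<open>The coefficient of Q^p in degree m is not yet known to be integral, but
            it is multiplied by the constant term of \<open>V\<close>, which vanishes.\<close>
          proof (cases "i < m")
            case True
            then have "fps_nth (Q ^ p) i = fps_nth (C ^ p) i"
              by (simp add: C_def fps_power_nth_cutoff)
            then show ?thesis using V C by (simp add: pR_mult fps_with_coeffsD RS_power)
          next
            case False
            then show ?thesis using V0 \<open>i \<in> {0..m}\<close> by (simp add: pR_zero)
          qed
        qed
        show ?thesis using pR_diff[OF pR_diff[OF pR_zero 1] 2] by (simp only: diff_0)
      qed
      finally show ?thesis by (simp add: pR_def)
    qed
  qed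
  then show ?thesis unfolding Q_def by (rule fps_with_coeffsI)
qed

end

section \<open>MUM operators and their systems\<close>

definition fps_diff_op :: "nat \<Rightarrow> (nat \<Rightarrow> 'a::comm_ring_1 fps) \<Rightarrow> 'a fps \<Rightarrow> 'a fps" where
  "fps_diff_op n a y = (fps_XD ^^ n) y + (\<Sum>i<n. a i * (fps_XD ^^ i) y)"

lemma fps_XD_pow_nth: "fps_nth ((fps_XD ^^ i) y) m = of_nat m ^ i * fps_nth y m"
  for y :: "'a::comm_ring_1 fps"
  by (simp add: fps_mult_fps_XD_shift)

lemma fps_XD_diff: "fps_XD (F - G) = fps_XD F - fps_XD G" for F G :: "'a::comm_ring_1 fps"
  by (simp add: fps_eq_iff algebra_simps)

lemma fps_XD_mult: "fps_XD (F * G) = fps_XD F * G + F * fps_XD G" for F G :: "'a::comm_ring_1 fps"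
  by (simp add: fps_XD_def algebra_simps)

lemma fps_XD_sum: "fps_XD (sum F I) = (\<Sum>i\<in>I. fps_XD (F i))" for F :: "_ \<Rightarrow> 'a::comm_ring_1 fps"
  by (simp add: fps_eq_iff fps_sum_nth sum_distrib_left)

lemma fps_XD_pow_diff: "(fps_XD ^^ i) (F - G) = (fps_XD ^^ i) F - (fps_XD ^^ i) G"
  for F G :: "'a::comm_ring_1 fps"
  by (simp add: fps_eq_iff fps_XD_pow_nth algebra_simps)

lemma fps_diff_op_diff: "fps_diff_op n a (y - z) = fps_diff_op n a y - fps_diff_op n a z"
  by (simp add: fps_diff_op_def fps_XD_pow_diff algebra_simps sum_subtractf)

lemma fps_XD_compose_X_power:
  fixes F :: "'a::idom fps"
  assumes "p > 0"
  shows "fps_XD (F oo fps_X ^ p) = of_nat p * (fps_XD F oo fps_X ^ p)"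
  using assms by (auto simp: fps_eq_iff fps_nth_compose_X_power fps_of_nat[symmetric] elim!: dvdE)

text \<open>Since a_i(0) = 0, each a_i \<delta>^i y starts above degree m, so only \<delta>^n
  contributes. The indicial polynomial m^n serves both in characteristic 0 and modulo p.\<close>

lemma fps_diff_op_nth_leading:
  assumes "MUM n a" "\<And>k. k < m \<Longrightarrow> fps_nth y k = 0"
  shows "fps_nth (fps_diff_op n a y) m = of_nat m ^ n * fps_nth y m"
proof -
  have "fps_nth (a i * (fps_XD ^^ i) y) m = 0" if "i < n" for i
    unfolding fps_mult_nth
  proof (rule sum.neutral, rule ballI)
    fix k assume "k \<in> {0..m}"
    then show "fps_nth (a i) k * fps_nth ((fps_XD ^^ i) y) (m - k) = 0"
      using assms that by (cases "k = 0") (auto simp: MUM_def fps_XD_pow_nth)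
  qed
  then show ?thesis by (simp add: fps_diff_op_def fps_sum_nth fps_XD_pow_nth)
qed

lemma MUM_solution_unique:
  fixes y :: "'a::field_char_0 fps"
  assumes "MUM n a" "fps_diff_op n a y = 0" "fps_nth y 0 = 0"
  shows "y = 0"
proof -
  have "fps_nth y m = 0" for m
  proof (induction m rule: less_induct)
    case (less m)
    then have "of_nat m ^ n * fps_nth y m = 0"
      using fps_diff_op_nth_leading[OF assms(1), of m y] assms(2) by simp
    then show ?case using assms(3) by (cases "m = 0") auto
  qed
  then show ?thesis by (simp add: fps_eq_iff)
qed

lemma sum_companion_mat:
  assumes "i < n"
  shows "(\<Sum>j<n. companion_mat n a $$ (i, j) * y j)
    = (if Suc i = n then - (\<Sum>j<n. a j * y j) else y (Suc i))"
proof (cases "Suc i = n")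
  case True
  then show ?thesis using assms by (auto simp: companion_mat_def sum_negf intro!: sum.cong)
next
  case False
  have "(\<Sum>j<n. companion_mat n a $$ (i, j) * y j) = (\<Sum>j<n. if j = Suc i then y j else 0)"
    using assms False by (intro sum.cong) (auto simp: companion_mat_def)
  then show ?thesis using assms False by simp
qed

lemma companion_system_solution:
  assumes y: "\<And>i. i < n \<Longrightarrow> fps_XD (y i) = (\<Sum>j<n. companion_mat n a $$ (i, j) * y j)" and "n > 0"
  shows "i < n \<Longrightarrow> y i = (fps_XD ^^ i) (y 0)" "fps_diff_op n a (y 0) = 0"
proof -
  show *: "y i = (fps_XD ^^ i) (y 0)" if "i < n" for i
    using that
  proof (induction i)
    case (Suc i)
    then show ?case using y[of i] by (simp add: sum_companion_mat)
  qed simp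
  obtain q where q: "n = Suc q" using \<open>n > 0\<close> by (cases n) auto
  then have qn: "q < n" "Suc q = n" by simp_all
  have "fps_XD (y q) = (\<Sum>j<n. companion_mat n a $$ (q, j) * y j)" by (rule y[OF qn(1)])
  also have "\<dots> = (if Suc q = n then - (\<Sum>j<n. a j * y j) else y (Suc q))"
    by (rule sum_companion_mat[OF qn(1)])
  also have "\<dots> = - (\<Sum>j<n. a j * y j)" using qn(2) by (rule if_P)
  finally have "fps_XD (y q) = - (\<Sum>j<n. a j * y j)" .
  moreover have "(\<Sum>j<n. a j * y j) = (\<Sum>j<n. a j * (fps_XD ^^ j) (y 0))"
    by (intro sum.cong refl arg_cong2[where f = times] *) simp
  moreover have "fps_XD (y q) = (fps_XD ^^ n) (y 0)"
    unfolding *[OF qn(1)] q by simp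
  ultimately show "fps_diff_op n a (y 0) = 0" by (simp add: fps_diff_op_def)
qed

text \<open>A solution vector consists of the derivatives of its entry 0, so scalar uniqueness
  applies. Two solution vectors can thus be identified by one constant term.\<close>

lemma MUM_system_unique:
  fixes y :: "nat \<Rightarrow> 'a::field_char_0 fps"
  assumes "MUM n a" "\<And>i. i < n \<Longrightarrow> fps_XD (y i) = (\<Sum>j<n. companion_mat n a $$ (i, j) * y j)"
    and "fps_nth (y 0) 0 = 0" and "i < n"
  shows "y i = 0"
proof -
  have "n > 0" using \<open>i < n\<close> by simp
  have "y 0 = 0"
    using companion_system_solution(2)[where y=y and n=n and a=a, OF assms(2) \<open>n > 0\<close>] assms(1,3) MUM_solution_unique by blast
  moreover have "(fps_XD ^^ i) (0 :: 'a fps) = 0" by (simp add: fps_eq_iff fps_XD_pow_nth)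
  ultimately show ?thesis
    using companion_system_solution(1)[where y=y and n=n and a=a, OF assms(2) \<open>n > 0\<close> \<open>i < n\<close>] by simp
qed

lemma fps_diff_op_system:
  assumes "fps_diff_op n a y = 0" "i < n"
  shows "fps_XD ((fps_XD ^^ i) y) = (\<Sum>j<n. companion_mat n a $$ (i, j) * (fps_XD ^^ j) y)"
  using assms by (auto simp: fps_diff_op_def sum_companion_mat add_eq_0_iff2)

text \<open>By the chain rule, \<delta> of F(z^p) is p times (\<delta>F)(z^p). Hence the term of
  \<delta>\<Phi> with A(z^p) cancels the one that arises from differentiating y(z^p). The
  inhomogeneity b is carried along for the logarithmic solution.\<close>

lemma frobenius_transport:
  fixes A \<phi> :: "nat \<Rightarrow> nat \<Rightarrow> 'a::idom fps"
  assumes p: "p > 0"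
    and \<phi>: "\<And>i j. i < n \<Longrightarrow> j < n \<Longrightarrow> fps_XD (\<phi> i j)
      = (\<Sum>k<n. A i k * \<phi> k j) - of_nat p * (\<Sum>k<n. \<phi> i k * (A k j oo fps_X ^ p))"
    and y: "\<And>i. i < n \<Longrightarrow> fps_XD (y i) = (\<Sum>j<n. A i j * y j) + b i"
    and i: "i < n"
  shows "fps_XD (\<Sum>j<n. \<phi> i j * (y j oo fps_X ^ p))
    = (\<Sum>k<n. A i k * (\<Sum>j<n. \<phi> k j * (y j oo fps_X ^ p)))
      + of_nat p * (\<Sum>j<n. \<phi> i j * (b j oo fps_X ^ p))"
proof -
  have X0: "fps_nth (fps_X ^ p :: 'a fps) 0 = 0" using p by simp
  let ?s = "\<lambda>F. F oo fps_X ^ p"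
  have "fps_XD (\<Sum>j<n. \<phi> i j * ?s (y j))
      = (\<Sum>j<n. fps_XD (\<phi> i j) * ?s (y j) + \<phi> i j * (of_nat p * ?s (fps_XD (y j))))"
    using p by (simp add: fps_XD_sum fps_XD_mult fps_XD_compose_X_power)
  also have "\<dots> = (\<Sum>j<n. ((\<Sum>k<n. A i k * \<phi> k j) - of_nat p * (\<Sum>k<n. \<phi> i k * ?s (A k j))) * ?s (y j)
       + \<phi> i j * (of_nat p * ((\<Sum>k<n. ?s (A j k) * ?s (y k)) + ?s (b j))))"
    using i by (intro sum.cong) (auto simp: \<phi> y fps_compose_add_distrib fps_compose_sum_distrib
        fps_compose_mult_distrib[OF X0])
  also have "\<dots> = (\<Sum>j<n. \<Sum>k<n. A i k * \<phi> k j * ?s (y j))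
      - of_nat p * (\<Sum>j<n. \<Sum>k<n. \<phi> i k * ?s (A k j) * ?s (y j))
      + of_nat p * (\<Sum>j<n. \<Sum>k<n. \<phi> i j * ?s (A j k) * ?s (y k))
      + of_nat p * (\<Sum>j<n. \<phi> i j * ?s (b j))"
    by (simp add: sum.distrib sum_subtractf sum_distrib_left sum_distrib_right algebra_simps)
  also have "(\<Sum>j<n. \<Sum>k<n. \<phi> i k * ?s (A k j) * ?s (y j)) = (\<Sum>j<n. \<Sum>k<n. \<phi> i j * ?s (A j k) * ?s (y k))"
    by (rule sum.swap)
  also have "(\<Sum>j<n. \<Sum>k<n. A i k * \<phi> k j * ?s (y j)) = (\<Sum>k<n. \<Sum>j<n. A i k * \<phi> k j * ?s (y j))"
    by (rule sum.swap)
  finally show ?thesis by (simp add: sum_distrib_left mult_ac)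
qed

text \<open>The i-th \<delta>-derivative of f log z + g is (\<delta>^i f) log z + (log_part f g i).\<close>

primrec log_part :: "'a::comm_ring_1 fps \<Rightarrow> 'a fps \<Rightarrow> nat \<Rightarrow> 'a fps" where
  "log_part f g 0 = g"
| "log_part f g (Suc i) = fps_XD (log_part f g i) + (fps_XD ^^ i) f"

lemma log_delta_linear: "log_delta [:b, c:] = [:fps_XD b + c, fps_XD c:]"
proof -
  have "map_poly fps_XD [:b, c:] = [:fps_XD b, fps_XD c:]"
    by (rule poly_eqI) (simp add: coeff_map_poly fps_XD_def coeff_pCons split: nat.split)
  then show ?thesis by (simp add: log_delta_def pderiv_pCons)
qed

lemma log_delta_pow:
  "(log_delta ^^ i) (Polynomial.smult f log_z + [:g:]) = [:log_part f g i, (fps_XD ^^ i) f:]"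
  by (induction i) (simp_all add: log_z_def log_delta_linear)

text \<open>As log z is the polynomial variable, these are the coefficients of log z and of 1 in the
  operator applied to f log z + g.\<close>

lemma diff_op_log_solution:
  assumes "diff_op n a (Polynomial.smult f log_z + [:g:]) = 0"
  shows "fps_diff_op n a f = 0"
    and "log_part f g n + (\<Sum>i<n. a i * log_part f g i) = 0"
proof -
  note * = assms[unfolded diff_op_def log_delta_pow, THEN arg_cong, of "\<lambda>P. poly.coeff P _"]
  show "fps_diff_op n a f = 0" using *[of 1] by (simp add: fps_diff_op_def coeff_sum)
  show "log_part f g n + (\<Sum>i<n. a i * log_part f g i) = 0" using *[of 0] by (simp add: coeff_sum)
qed

text \<open>The inhomogeneity is what \<delta> log z = 1 contributes once the log part is
  separated.\<close>

lemma log_part_system: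
  assumes "log_part f g n + (\<Sum>i<n. a i * log_part f g i) = 0" "i < n"
  shows "fps_XD (log_part f g i)
    = (\<Sum>j<n. companion_mat n a $$ (i, j) * log_part f g j) + - (fps_XD ^^ i) f"
proof -
  have "fps_XD (log_part f g i) = log_part f g (Suc i) + - (fps_XD ^^ i) f" by simp
  also have "log_part f g (Suc i) = (\<Sum>j<n. companion_mat n a $$ (i, j) * log_part f g j)"
    unfolding sum_companion_mat[OF assms(2)]
    using assms(1)[folded eq_neg_iff_add_eq_0] by (auto simp del: log_part.simps)
  finally show ?thesis .
qed

section \<open>Consequences of a Frobenius structure\<close>

context p_local_subring
begin

text \<open>Since k div p < m, substituting z^p uses only coefficients of F below m. This lag makes
  the Frobenius relations usable as recursions.\<close>

lemma compose_power_nth_mem: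
  assumes "\<And>k. k < m \<Longrightarrow> fps_nth F k \<in> R" "m > 0" "k \<le> m"
  shows "fps_nth (F oo fps_X ^ p) k \<in> R"
proof -
  have "k div p < m"
    using assms(2,3) prime_gt_1_nat[OF prime_p] by (cases "k = 0") (auto intro: less_le_trans[OF div_less_dividend])
  then show ?thesis using assms(1) by (simp add: fps_nth_compose_X_power zero_mem)
qed

lemma mult_nth_mem:
  assumes "\<And>k. k \<le> m \<Longrightarrow> fps_nth F k \<in> R" "\<And>k. k \<le> m \<Longrightarrow> fps_nth G k \<in> R" "k \<le> m"
  shows "fps_nth (F * G) k \<in> R"
  unfolding fps_mult_nth using assms by (intro sum_mem mult_mem) auto

end

text \<open>The setting in entrywise form, with the matrix as a function of two indices. As R
  carries no norm, |\<phi>_00(0)| = 1 becomes invertibility in R.\<close>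

locale MUM_frobenius = p_local_subring R p for R :: "'a::field_char_0 set" and p +
  fixes n :: nat and a :: "nat \<Rightarrow> 'a fps" and f g :: "'a fps" and \<phi> :: "nat \<Rightarrow> nat \<Rightarrow> 'a fps"
  assumes n_ge_2: "n \<ge> 2"
    and a_mem: "\<And>i. i < n \<Longrightarrow> a i \<in> RS"
    and MUM: "MUM n a"
    and f_0: "fps_nth f 0 = 1"
    and g_0: "fps_nth g 0 = 0"
    and f_sol: "fps_diff_op n a f = 0"
    and log_sol: "log_part f g n + (\<Sum>i<n. a i * log_part f g i) = 0"
    and \<phi>_mem: "\<And>i j. i < n \<Longrightarrow> j < n \<Longrightarrow> \<phi> i j \<in> RS"
    and \<phi>_eq: "\<And>i j. i < n \<Longrightarrow> j < n \<Longrightarrow> fps_XD (\<phi> i j)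
      = (\<Sum>k<n. companion_mat n a $$ (i, k) * \<phi> k j)
        - of_nat p * (\<Sum>k<n. \<phi> i k * (companion_mat n a $$ (k, j) oo fps_X ^ p))"
    and \<phi>_unit: "inverse (fps_nth (\<phi> 0 0) 0) \<in> R" "fps_nth (\<phi> 0 0) 0 \<noteq> 0"
begin

abbreviation frob :: "'a fps \<Rightarrow> 'a fps" where "frob F \<equiv> F oo fps_X ^ p"

text \<open>With \<tau> = log z + t, the series e_i is \<delta>^i (f \<tau>) - \<tau> \<delta>^i f, from which log z cancels.\<close>

definition u :: "nat \<Rightarrow> 'a fps" where "u i = (fps_XD ^^ i) f"
definition h :: "nat \<Rightarrow> 'a fps" where "h i = log_part f g i"
definition t :: "'a fps" where "t = g / f"
definition w :: "'a fps" where "w = 1 + fps_XD t"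
definition e :: "nat \<Rightarrow> 'a fps" where "e i = h i - t * u i"
definition c :: 'a where "c = fps_nth (\<phi> 0 0) 0"
text \<open>The multiple of the solution f that appears when the Frobenius matrix acts on the
  logarithmic solution; its value is forced by g(0) = 0 and f(0) = 1.\<close>

definition \<beta> :: 'a where "\<beta> = fps_nth (\<Sum>j<n. \<phi> 0 j * frob (h j)) 0"

lemma X0: "fps_nth (fps_X ^ p :: 'a fps) 0 = 0"
  using p_pos by simp

lemma u_0: "u 0 = f" and u_Suc: "u (Suc i) = fps_XD (u i)"
  by (simp_all add: u_def)

lemma t_mult_f: "t * f = g"
proof -
  have "f dvd g" using f_0 by (simp add: fps_is_unit_iff unit_imp_dvd)
  then show ?thesis by (simp add: t_def)
qed

lemma t_0: "fps_nth t 0 = 0"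
  using arg_cong[OF t_mult_f, of "\<lambda>F. fps_nth F 0"] f_0 g_0 by simp

lemma e_0: "e 0 = 0"
  by (simp add: e_def h_def u_0 t_mult_f)

text \<open>Differentiating \<tau> \<delta>^i f yields the extra term w \<delta>^i f. Starting from
  e_0 = 0, every e_i is thus built from w, the u_j and \<delta>, without t.\<close>

lemma e_Suc: "e (Suc i) = fps_XD (e i) + w * u i"
  by (simp add: e_def h_def u_def w_def fps_XD_diff fps_XD_mult algebra_simps)

lemma h_eq: "h i = e i + t * u i"
  by (simp add: e_def)

section \<open>Images of solution vectors under the Frobenius matrix\<close>

lemma u_system: "i < n \<Longrightarrow> fps_XD (u i) = (\<Sum>j<n. companion_mat n a $$ (i, j) * u j)"
  unfolding u_def by (rule fps_diff_op_system[OF f_sol])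

lemma h_system: "i < n \<Longrightarrow> fps_XD (h i) = (\<Sum>j<n. companion_mat n a $$ (i, j) * h j) + - u i"
  unfolding u_def h_def by (rule log_part_system[OF log_sol])

text \<open>By \<open>frobenius_transport\<close> both sides are solution vectors, so it suffices to
  compare constant terms in entry 0. There u_j(0) = 0 for j > 0 leaves only c.\<close>

lemma frobenius_u:
  assumes "i < n"
  shows "(\<Sum>j<n. \<phi> i j * frob (u j)) = fps_const c * u i"
proof -
  define y where "y i = (\<Sum>j<n. \<phi> i j * frob (u j)) - fps_const c * u i" for i
  have "y i = 0"
  proof (rule MUM_system_unique[OF MUM _ _ assms])
    fix i assume i: "i < n"
    have 1: "fps_XD (\<Sum>j<n. \<phi> i j * frob (u j)) = (\<Sum>k<n. companion_mat n a $$ (i, k) * (\<Sum>j<n. \<phi> k j * frob (u j)))"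
      using frobenius_transport[where b = "\<lambda>_. 0" and A = "\<lambda>i j. companion_mat n a $$ (i, j)", OF p_pos \<phi>_eq _ i, of u]
      by (simp add: u_system)
    have 2: "fps_XD (fps_const c * u i) = (\<Sum>j<n. companion_mat n a $$ (i, j) * (fps_const c * u j))"
      by (simp only: fps_XD_mult_const u_system[OF i] sum_distrib_left mult.left_commute)
    show "fps_XD (y i) = (\<Sum>j<n. companion_mat n a $$ (i, j) * y j)"
      unfolding y_def fps_XD_diff 1 2 by (simp add: right_diff_distrib sum_subtractf)
  next
    have "fps_nth (\<phi> 0 j * frob (u j)) 0 = (if j = 0 then c else 0)" for j
      by (cases j) (simp_all add: u_0 u_Suc f_0 c_def)
    then have "fps_nth (\<Sum>j<n. \<phi> 0 j * frob (u j)) 0 = c"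
      using n_ge_2 by (simp add: fps_sum_nth)
    then show "fps_nth (y 0) 0 = 0" by (simp add: y_def u_0 f_0)
  qed
  then show ?thesis by (simp add: y_def)
qed

text \<open>Transport turns the inhomogeneity -u into -p c u, which is exactly that of p c h. The
  difference solves the homogeneous system and is therefore a constant multiple of u.\<close>

lemma frobenius_h:
  assumes "i < n"
  shows "(\<Sum>j<n. \<phi> i j * frob (h j)) = of_nat p * fps_const c * h i + fps_const \<beta> * u i"
proof -
  define y where "y i = (\<Sum>j<n. \<phi> i j * frob (h j)) - of_nat p * fps_const c * h i - fps_const \<beta> * u i" for i
  have "y i = 0"
  proof (rule MUM_system_unique[OF MUM _ _ assms])
    fix i assume i: "i < n"
    have "fps_XD (\<Sum>j<n. \<phi> i j * frob (h j))
        = (\<Sum>k<n. companion_mat n a $$ (i, k) * (\<Sum>j<n. \<phi> k j * frob (h j)))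
          + of_nat p * (\<Sum>j<n. \<phi> i j * frob (- u j))"
      by (rule frobenius_transport[OF p_pos \<phi>_eq h_system i])
    also have "(\<Sum>j<n. \<phi> i j * frob (- u j)) = - (fps_const c * u i)"
      using frobenius_u[OF i] by (simp add: fps_compose_uminus sum_negf)
    finally have 1: "fps_XD (\<Sum>j<n. \<phi> i j * frob (h j))
        = (\<Sum>k<n. companion_mat n a $$ (i, k) * (\<Sum>j<n. \<phi> k j * frob (h j)))
          - of_nat p * fps_const c * u i" by (simp add: algebra_simps)
    have 2: "fps_XD (of_nat p * fps_const c * h i)
        = (\<Sum>j<n. companion_mat n a $$ (i, j) * (of_nat p * fps_const c * h j)) - of_nat p * fps_const c * u i"
    proof -
      have "of_nat p * fps_const c = fps_const (of_nat p * c)" by (simp add: fps_of_nat[symmetric])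
      then have "fps_XD (of_nat p * fps_const c * h i) = of_nat p * fps_const c * fps_XD (h i)"
        by (simp only: fps_XD_mult_const)
      also have "\<dots> = of_nat p * fps_const c * (\<Sum>j<n. companion_mat n a $$ (i, j) * h j) - of_nat p * fps_const c * u i"
        unfolding h_system[OF i] by (simp only: add_uminus_conv_diff right_diff_distrib)
      also have "of_nat p * fps_const c * (\<Sum>j<n. companion_mat n a $$ (i, j) * h j)
          = (\<Sum>j<n. companion_mat n a $$ (i, j) * (of_nat p * fps_const c * h j))"
        unfolding sum_distrib_left by (intro sum.cong refl mult.left_commute)
      finally show ?thesis .
    qed
    have 3: "fps_XD (fps_const \<beta> * u i) = (\<Sum>j<n. companion_mat n a $$ (i, j) * (fps_const \<beta> * u j))"
      by (simp only: fps_XD_mult_const u_system[OF i] sum_distrib_left mult.left_commute)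
    show "fps_XD (y i) = (\<Sum>j<n. companion_mat n a $$ (i, j) * y j)"
    proof -
      have "X - P - (Y - P) - Z = X - Y - Z" for X P Y Z :: "'a fps" by simp
      then show ?thesis unfolding y_def fps_XD_diff 1 2 3 by (simp only: right_diff_distrib sum_subtractf)
    qed
  next
    show "fps_nth (y 0) 0 = 0"
      by (simp add: y_def u_0 f_0 \<beta>_def h_def g_0)
  qed
  then show ?thesis unfolding y_def by (simp only: diff_diff_eq right_minus_eq)
qed

text \<open>This is c (p \<tau> - \<tau>^\<sigma>) + \<beta>, again without log z since log z^p = p log z.\<close>

definition \<kappa> :: "'a fps" where
  "\<kappa> = of_nat p * fps_const c * t + fps_const \<beta> - fps_const c * frob t"

text \<open>This is \<open>frobenius_h\<close> minus \<open>frob t\<close> times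
  \<open>frobenius_u\<close>, with h_i = e_i + t u_i. The factor \<kappa> is the same for every i,
  which permits eliminating it between two rows.\<close>

lemma frobenius_e:
  assumes "i < n"
  shows "(\<Sum>j<n. \<phi> i j * frob (e j)) = of_nat p * fps_const c * e i + u i * \<kappa>"
proof -
  have "(\<Sum>j<n. \<phi> i j * frob (e j)) = (\<Sum>j<n. \<phi> i j * frob (h j)) - frob t * (\<Sum>j<n. \<phi> i j * frob (u j))"
    by (simp add: e_def fps_compose_sub_distrib fps_compose_mult_distrib[OF X0] sum_distrib_left
        sum_subtractf algebra_simps)
  also have "\<dots> = of_nat p * fps_const c * (e i + t * u i) + fps_const \<beta> * u i - frob t * (fps_const c * u i)"
    unfolding frobenius_u[OF assms] frobenius_h[OF assms] h_eq[of i, symmetric] ..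
  finally show ?thesis by (simp add: \<kappa>_def algebra_simps)
qed

text \<open>Entry 0 of \<open>frobenius_u\<close> expresses the coefficient of c f in degree m > 0
  by coefficients of f below m, and c is a unit.\<close>

lemma f_mem: "f \<in> RS"
proof (rule fps_with_coeffsI)
  fix m
  show "fps_nth f m \<in> R"
  proof (induction m rule: less_induct)
    case (less m)
    show ?case
    proof (cases "m = 0")
      case True
      then show ?thesis by (simp add: f_0 one_mem)
    next
      case False
      have "fps_nth (u j) k \<in> R" if "k < m" for j k
        using less.IH[OF that] by (simp add: u_def fps_XD_pow_nth R_intros)
      then have "fps_nth (frob (u j)) k \<in> R" if "k \<le> m" for j k
        using that False by (intro compose_power_nth_mem[of m]) auto
      then have "fps_nth (\<phi> 0 j * frob (u j)) m \<in> R" if "j < n" for j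
        using that n_ge_2 by (intro mult_nth_mem[of m]) (auto intro: fps_with_coeffsD[OF \<phi>_mem])
      then have "fps_nth (\<Sum>j<n. \<phi> 0 j * frob (u j)) m \<in> R"
        unfolding fps_sum_nth by (intro sum_mem) auto
      then have "c * fps_nth f m \<in> R" using frobenius_u[of 0] n_ge_2 by (simp add: u_0)
      then have "inverse c * (c * fps_nth f m) \<in> R" by (rule mult_mem[rotated]) (simp add: c_def \<phi>_unit)
      then have "(inverse c * c) * fps_nth f m \<in> R" by (simp only: mult.assoc)
      then show ?thesis using \<phi>_unit(2) by (simp add: c_def)
    qed
  qed
qed

lemma u_mem: "u i \<in> RS"
  unfolding u_def by (intro RS_XD_pow f_mem)

lemma inverse_f_mem: "inverse f \<in> RS"
  using f_mem f_0 by (rule RS_inverse)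

lemma f_inverse: "f * inverse f = 1"
  using f_0 by (simp add: inverse_mult_eq_1')

section \<open>Columns of the Frobenius matrix modulo p\<close>

lemma companion_mem: "i < n \<Longrightarrow> j < n \<Longrightarrow> companion_mat n a $$ (i, j) \<in> RS"
  by (auto simp: companion_mat_def RS_uminus a_mem RS_zero RS_one)

text \<open>Modulo p the Frobenius equation loses the term p \<Phi> A(z^p) and becomes
  \<delta>\<Phi> = A \<Phi>, so each column is a solution vector of L modulo p.\<close>

lemma column_cong:
  assumes "j < n"
  shows "i < n \<Longrightarrow> (fps_XD ^^ i) (\<phi> 0 j) - \<phi> i j \<in> pRS"
    and "fps_diff_op n a (\<phi> 0 j) \<in> pRS"
proof -
  define E where "E i = (\<Sum>k<n. \<phi> i k * frob (companion_mat n a $$ (k, j)))" for i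
  have E: "of_nat p * E i \<in> pRS" if "i < n" for i
    unfolding E_def using assms that
    by (intro pRS_p_mult RS_sum RS_mult RS_compose_power companion_mem \<phi>_mem) auto
  have step: "fps_XD (\<phi> i j) = (if Suc i = n then - (\<Sum>k<n. a k * \<phi> k j) else \<phi> (Suc i) j) - of_nat p * E i"
    if "i < n" for i
    using \<phi>_eq[OF that assms] sum_companion_mat[OF that, of a "\<lambda>k. \<phi> k j"] by (simp add: E_def)
  show *: "(fps_XD ^^ i) (\<phi> 0 j) - \<phi> i j \<in> pRS" if "i < n" for i
    using that
  proof (induction i)
    case 0
    show ?case by (simp add: pRS_zero)
  next
    case (Suc i)
    have "(fps_XD ^^ Suc i) (\<phi> 0 j) - \<phi> (Suc i) j
        = fps_XD ((fps_XD ^^ i) (\<phi> 0 j) - \<phi> i j) - of_nat p * E i"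
      using step[of i] Suc.prems by (simp add: fps_XD_diff)
    also have "\<dots> \<in> pRS" using Suc by (intro pRS_diff[OF pRS_XD E]) auto
    finally show ?case .
  qed
  obtain q where q: "n = Suc q" using n_ge_2 by (cases n) auto
  have "fps_diff_op n a (\<phi> 0 j) = fps_XD ((fps_XD ^^ q) (\<phi> 0 j) - \<phi> q j) - of_nat p * E q
      + (\<Sum>k<n. a k * ((fps_XD ^^ k) (\<phi> 0 j) - \<phi> k j))"
    using step[of q] by (simp add: fps_diff_op_def fps_XD_diff sum_subtractf algebra_simps q del: sum.lessThan_Suc)
  also have "\<dots> \<in> pRS"
    using q by (intro pRS_add[OF pRS_diff[OF pRS_XD[OF *] E] pRS_sum[OF pRS_mult[OF a_mem *]]]) auto
  finally show "fps_diff_op n a (\<phi> 0 j) \<in> pRS" .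
qed

text \<open>A MUM operator has only one solution modulo p up to series in z^p, so the columns of
  the Frobenius matrix are proportional modulo p.\<close>

lemma log_derivative_cong:
  assumes j: "j < n"
  shows "fps_XD (\<phi> 0 j * inverse f) \<in> pRS"
proof (rule fps_with_coeffsI)
  define s where "s = \<phi> 0 j * inverse f"
  have s: "s \<in> RS" unfolding s_def using j n_ge_2 by (intro RS_mult \<phi>_mem inverse_f_mem) auto
  have sf: "s * f = \<phi> 0 j" using f_inverse by (simp add: s_def mult_ac)
  fix m
  have "of_nat m * fps_nth s m \<in> pR"
  proof (induction m rule: less_induct)
    case (less m)
    \<comment> \<open>By the induction hypothesis \<delta>S is divisible by p, so S behaves like a
      constant modulo p and S f is again a solution modulo p.\<close>
    define S where "S = fps_cutoff m s"
    have S: "S \<in> RS" using s by (auto intro!: fps_with_coeffsI simp: S_def fps_with_coeffsD zero_mem)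
    have XD_S: "fps_XD S \<in> pRS" using less.IH by (auto intro!: fps_with_coeffsI simp: S_def pR_zero)
    have D: "(fps_XD ^^ i) (S * f) - S * u i \<in> pRS" for i
    proof (induction i)
      case 0
      show ?case by (simp add: u_0 pRS_zero)
    next
      case (Suc i)
      have "(fps_XD ^^ Suc i) (S * f) - S * u (Suc i)
          = fps_XD ((fps_XD ^^ i) (S * f) - S * u i) + u i * fps_XD S"
        by (simp add: fps_XD_diff fps_XD_mult u_Suc)
      also have "\<dots> \<in> pRS" by (intro pRS_add pRS_XD pRS_mult Suc.IH XD_S u_mem)
      finally show ?case .
    qed
    have "fps_diff_op n a (S * f) = fps_diff_op n a (S * f) - S * fps_diff_op n a f"
      by (simp add: f_sol)
    also have "\<dots> = ((fps_XD ^^ n) (S * f) - S * u n) + (\<Sum>i<n. a i * ((fps_XD ^^ i) (S * f) - S * u i))"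
      by (simp add: fps_diff_op_def u_def sum_distrib_left sum_subtractf algebra_simps)
    also have "\<dots> \<in> pRS" by (intro pRS_add pRS_sum pRS_mult D a_mem) auto
    finally have "fps_diff_op n a (\<phi> 0 j - S * f) \<in> pRS"
      unfolding fps_diff_op_diff by (intro pRS_diff column_cong j)
    then have "fps_nth (fps_diff_op n a (\<phi> 0 j - S * f)) m \<in> pR" by (rule fps_with_coeffsD)
    \<comment> \<open>The remainder is a solution modulo p that vanishes below degree m and has
      coefficient s_m there, so its indicial term m^n s_m is divisible by p.\<close>
    moreover have "\<phi> 0 j - S * f = fps_X ^ m * (fps_shift m s * f)"
    proof -
      have "s - S = fps_X ^ m * fps_shift m s"
        by (auto simp: S_def fps_eq_iff fps_X_power_mult_nth)
      then show ?thesis unfolding sf[symmetric] by (simp add: left_diff_distrib[symmetric] mult.assoc)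
    qed
    ultimately have "of_nat m ^ n * fps_nth s m \<in> pR"
      using fps_diff_op_nth_leading[OF MUM, of m "\<phi> 0 j - S * f"]
      by (simp add: fps_X_power_mult_nth f_0)
    then show ?case by (rule pR_cancel_nat_power) (rule fps_with_coeffsD[OF s])
  qed
  then show "fps_nth (fps_XD (\<phi> 0 j * inverse f)) m \<in> pR" by (simp only: fps_XD_nth s_def)
qed

text \<open>Modulo p, \<phi>_1j is \<delta>\<phi>_0j and the expression becomes f^2
  \<delta>(\<phi>_0j / f), whose last factor is divisible by p.\<close>

lemma wronskian_cong:
  assumes j: "j < n"
  shows "f * \<phi> 1 j - fps_XD f * \<phi> 0 j \<in> pRS"
proof -
  define s where "s = \<phi> 0 j * inverse f"
  have sf: "\<phi> 0 j = s * f" using f_inverse by (simp add: s_def mult_ac)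
  have "fps_XD (\<phi> 0 j) - \<phi> 1 j \<in> pRS" using column_cong(1)[OF j, of 1] n_ge_2 by simp
  then have "f * (fps_XD (\<phi> 0 j) - \<phi> 1 j) \<in> pRS" by (rule pRS_mult[OF f_mem])
  moreover have "f * f * fps_XD s \<in> pRS"
    unfolding s_def by (intro pRS_mult RS_mult f_mem log_derivative_cong j)
  ultimately have "f * f * fps_XD s - f * (fps_XD (\<phi> 0 j) - \<phi> 1 j) \<in> pRS" by (rule pRS_diff[rotated])
  also have "f * f * fps_XD s - f * (fps_XD (\<phi> 0 j) - \<phi> 1 j) = f * \<phi> 1 j - fps_XD f * \<phi> 0 j"
    by (simp add: sf fps_XD_mult algebra_simps)
  finally show ?thesis .
qed

lemma e_nth_mem:
  assumes "\<And>k. k < m \<Longrightarrow> fps_nth w k \<in> R" "k < m"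
  shows "fps_nth (e i) k \<in> R"
proof (induction i)
  case 0
  show ?case by (simp add: e_0 zero_mem)
next
  case (Suc i)
  have "fps_nth (w * u i) k \<in> R"
    using assms by (intro mult_nth_mem[of k]) (auto intro: fps_with_coeffsD[OF u_mem])
  then show ?case using Suc by (simp add: e_Suc R_intros)
qed

text \<open>Taking f times row 1 minus \<delta>f times row 0 of \<open>frobenius_e\<close> removes
  \<kappa>, and with it t; as e_0 = 0 and e_1 = w f, the right side is p c f^2 w. By
  \<open>wronskian_cong\<close> the left side is divisible by p too, so p cancels and an integral
  recursion remains.\<close>

lemma w_mem: "w \<in> RS"
proof -
  define v where "v = f * f * w"
  have w_v: "w = inverse f * inverse f * v"
    unfolding v_def using f_inverse by (metis mult.assoc mult.commute mult_1)
  have "\<exists>d\<in>RS. f * \<phi> 1 j - fps_XD f * \<phi> 0 j = of_nat p * d" if "j < n" for j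
    using wronskian_cong[OF that] pRS_iff by blast
  then obtain d where d: "\<And>j. j < n \<Longrightarrow> d j \<in> RS"
      "\<And>j. j < n \<Longrightarrow> f * \<phi> 1 j - fps_XD f * \<phi> 0 j = of_nat p * d j" by metis
  have e_1: "e 1 = w * f" using e_Suc[of 0] by (simp add: e_0 u_0 fps_XD_def)
  have u_1: "u 1 = fps_XD f" using u_Suc[of 0] by (simp add: u_0)
  have "of_nat p * (\<Sum>j<n. d j * frob (e j)) = (\<Sum>j<n. (f * \<phi> 1 j - fps_XD f * \<phi> 0 j) * frob (e j))"
    unfolding sum_distrib_left by (intro sum.cong refl) (simp only: d(2) lessThan_iff mult.assoc)
  also have "\<dots> = f * (\<Sum>j<n. \<phi> 1 j * frob (e j)) - fps_XD f * (\<Sum>j<n. \<phi> 0 j * frob (e j))"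
    by (simp add: sum_distrib_left sum_subtractf algebra_simps)
  also have "\<dots> = of_nat p * (fps_const c * v)"
    using frobenius_e[of 0] frobenius_e[of 1] n_ge_2
    by (simp add: e_0 e_1[simplified] u_0 u_1[simplified] v_def algebra_simps)
  finally have "(\<Sum>j<n. d j * frob (e j)) = fps_const c * v"
    using p_pos by (simp add: fps_of_nat[symmetric])
  then have v_eq: "inverse c * fps_nth (\<Sum>j<n. d j * frob (e j)) m = fps_nth v m" for m
    using \<phi>_unit(2) by (simp add: c_def)
  have "fps_nth v m \<in> R" for m
  proof (induction m rule: less_induct)
    case (less m)
    show ?case
    proof (cases "m = 0")
      case True
      \<comment> \<open>Degree 0 is settled directly by w(0) = 1, because there \<open>frob\<close>
        brings no drop in degree.\<close>
      then show ?thesis by (simp add: v_def f_0 w_def one_mem)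
    next
      case False
      have "fps_nth w k \<in> R" if "k < m" for k
        unfolding w_v
      proof (rule mult_nth_mem[of k])
        show "fps_nth (inverse f * inverse f) l \<in> R" for l
          using RS_mult[OF inverse_f_mem inverse_f_mem] by (rule fps_with_coeffsD)
      qed (use that less.IH in auto)
      then have "fps_nth (frob (e j)) k \<in> R" if "k \<le> m" for j k
        using that False by (intro compose_power_nth_mem[of m] e_nth_mem[of m]) auto
      then have "fps_nth (d j * frob (e j)) m \<in> R" if "j < n" for j
        using that by (intro mult_nth_mem[of m]) (auto intro: fps_with_coeffsD d(1))
      then have "fps_nth (\<Sum>j<n. d j * frob (e j)) m \<in> R"
        unfolding fps_sum_nth by (intro sum_mem) auto
      then show ?thesis unfolding v_eq[symmetric] by (intro mult_mem) (simp_all add: c_def \<phi>_unit)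
    qed
  qed
  then have "v \<in> RS" by (rule fps_with_coeffsI)
  then show ?thesis unfolding w_v by (intro RS_mult inverse_f_mem)
qed

text \<open>Row 0 of \<open>frobenius_e\<close> has e_0 = 0, so f \<kappa> is integral, hence also
  \<kappa> and its constant term \<beta>. Dividing \<beta> - \<kappa> by the unit c gives the
  hypothesis of \<open>dwork_exp_mem\<close>.\<close>

theorem exp_power_mem: "(fps_exp 1 oo (g / f)) ^ p \<in> RS"
  unfolding t_def[symmetric]
proof (rule dwork_exp_mem)
  show "fps_nth t 0 = 0" by (rule t_0)
  have "e j \<in> RS" for j
    using e_nth_mem fps_with_coeffsD[OF w_mem] by (intro fps_with_coeffsI) blast
  then have "(\<Sum>j<n. \<phi> 0 j * frob (e j)) \<in> RS"
    using n_ge_2 by (intro RS_sum RS_mult RS_compose_power \<phi>_mem) auto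
  then have "f * \<kappa> \<in> RS" using frobenius_e[of 0] n_ge_2 by (simp add: e_0 u_0)
  then have "inverse f * (f * \<kappa>) \<in> RS" by (rule RS_mult[OF inverse_f_mem])
  then have \<kappa>: "\<kappa> \<in> RS" using f_inverse by (metis mult.assoc mult.commute mult_1)
  have "fps_nth \<kappa> 0 = \<beta>" by (simp add: \<kappa>_def t_0)
  then have "\<beta> \<in> R" using fps_with_coeffsD[OF \<kappa>] by metis
  then have "fps_const (inverse c) * (fps_const \<beta> - \<kappa>) \<in> RS"
    using \<kappa> by (intro RS_mult RS_diff RS_const) (simp_all add: c_def \<phi>_unit)
  also have "fps_const \<beta> - \<kappa> = fps_const c * (frob t - of_nat p * t)"
    by (simp add: \<kappa>_def algebra_simps)
  also have "fps_const (inverse c) * (fps_const c * (frob t - of_nat p * t))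
      = (fps_const (inverse c) * fps_const c) * (frob t - of_nat p * t)"
    by (rule mult.assoc[symmetric])
  also have "fps_const (inverse c) * fps_const c = 1"
    using \<phi>_unit(2) by (simp add: c_def)
  finally show "frob t - of_nat p * t \<in> RS" by simp
qed

end

section \<open>Arithmetic of the p-adic integers\<close>

lemma padic_residue_0 [simp]: "padic_residue (x :: 'p::prime_card padic_int) 0 = 0"
  using padic_residue_mod[of x 0] by simp

lemma padic_int_eqI: "(\<And>n. padic_residue x n = padic_residue y n) \<Longrightarrow> x = y"
  by transfer auto

lemma padic_residue_times:
  "padic_residue (x * y) n = padic_residue x n * padic_residue y n mod int CARD('p) ^ n"
  for x y :: "'p::prime_card padic_int"
  by transfer simp

lemma padic_residue_power:
  "padic_residue (x ^ k) n = padic_residue x n ^ k mod int CARD('p) ^ n"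
  for x :: "'p::prime_card padic_int"
proof (induction k)
  case 0
  show ?case by (simp add: one_padic_int.rep_eq)
next
  case (Suc k)
  then show ?case by (simp add: padic_residue_times mod_simps)
qed

lemma padic_residue_minus:
  "padic_residue (x - y) n = (padic_residue x n - padic_residue y n) mod int CARD('p) ^ n"
  for x y :: "'p::prime_card padic_int"
  by transfer simp

text \<open>Dividing by p costs one digit: the residue of the quotient modulo p^n is the residue of
  x modulo p^(n+1), divided by p.\<close>

lemma padic_int_divisible_by_p:
  fixes x :: "'p::prime_card padic_int"
  assumes "padic_residue x 1 = 0"
  obtains y where "x = of_nat CARD('p) * y"
proof -
  let ?p = "int CARD('p)"
  have p: "?p > 0" using padic_modulus_pos[where 'p='p, of 1] by simp
  have dv: "?p dvd padic_residue x (Suc n)" for n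
    using padic_residue_eq_0_iff[of 1 "Suc n" x] assms by simp
  have "(padic_residue x (Suc (Suc n)) div ?p) mod ?p ^ n = padic_residue x (Suc n) div ?p" for n
  proof -
    obtain z where z: "padic_residue x (Suc (Suc n)) = ?p * z" using dv by blast
    have "padic_residue x (Suc n) = ?p * z mod ?p ^ Suc n"
      unfolding z[symmetric] by (rule padic_residue_mod_le[symmetric]) simp
    also have "\<dots> = ?p * (z mod ?p ^ n)" by (simp only: power_Suc mult_mod_right)
    finally show ?thesis using p z by simp
  qed
  moreover have "0 \<le> padic_residue x (Suc n) div ?p" "padic_residue x (Suc n) div ?p < ?p ^ n" for n
  proof -
    have "0 \<le> padic_residue x (Suc n)" "padic_residue x (Suc n) < ?p ^ n * ?p"
      using padic_residue[of x] by (auto simp: mult.commute dest: spec[of _ "Suc n"])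
    moreover have "padic_residue x (Suc n) div ?p * ?p \<le> padic_residue x (Suc n)"
      using p by (simp add: minus_mod_eq_div_mult[symmetric])
    ultimately have "padic_residue x (Suc n) div ?p * ?p < ?p ^ n * ?p" by linarith
    then show "padic_residue x (Suc n) div ?p < ?p ^ n" using p by simp
    show "0 \<le> padic_residue x (Suc n) div ?p"
      using \<open>0 \<le> padic_residue x (Suc n)\<close> p by (simp only: pos_imp_zdiv_nonneg_iff)
  qed
  ultimately have "padic_residue (Abs_padic_int (\<lambda>n. padic_residue x (Suc n) div ?p) :: 'p padic_int) n
      = padic_residue x (Suc n) div ?p" for n
    by (subst Abs_padic_int_inverse) auto
  then have "padic_residue (of_nat CARD('p) * (Abs_padic_int (\<lambda>n. padic_residue x (Suc n) div ?p) :: 'p padic_int)) n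
      = padic_residue x n" for n
    using padic_residue_mod_le[of n "Suc n" x] dv[of n]
    by (simp add: padic_residue_times padic_residue_of_nat mod_simps)
  then show ?thesis by (metis padic_int_eqI that)
qed

text \<open>Inverses are taken modulo each p^n; their uniqueness makes them compatible, so they
  define a p-adic integer.\<close>

lemma padic_int_unit:
  fixes x :: "'p::prime_card padic_int"
  assumes "padic_residue x 1 \<noteq> 0"
  obtains y where "x * y = 1"
proof -
  let ?p = "int CARD('p)"
  have "prime ?p" by (rule prime_card_int)
  \<comment> \<open>Modulo p^0 = 1 the only representative is 0, which the case n = 0
    supplies.\<close>
  define y :: "nat \<Rightarrow> int" where "y n = (if n = 0 then 0 else modular_inverse (?p ^ n) (padic_residue x n))" for n
  have cop: "coprime (padic_residue x n) (?p ^ n)" if "n > 0" for n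
  proof -
    have "\<not> ?p dvd padic_residue x n" using padic_residue_eq_0_iff[of 1 n x] assms that by simp
    then have "coprime ?p (padic_residue x n)" using \<open>prime ?p\<close> by (simp add: prime_imp_coprime)
    then show ?thesis by (simp add: coprime_commute)
  qed
  have inv: "[padic_residue x n * y n = 1] (mod ?p ^ n)" for n
    using cong_modular_inverse1[OF cop, of n] by (cases "n = 0") (auto simp: y_def)
  have range: "0 \<le> y n" "y n < ?p ^ n" for n
    by (auto simp: y_def modular_inverse_int_nonneg modular_inverse_int_less)
  have "y (Suc n) mod ?p ^ n = y n" for n
  proof (cases "n = 0")
    case False
    have "[padic_residue x (Suc n) * y (Suc n) = 1] (mod ?p ^ n)"
      using inv[of "Suc n"] by (rule cong_dvd_modulus) (simp add: le_imp_power_dvd)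
    moreover have "[padic_residue x (Suc n) = padic_residue x n] (mod ?p ^ n)"
      using padic_residue_mod_le[of n "Suc n" x] padic_residue_mod[of x n] by (simp add: cong_def)
    ultimately have "[padic_residue x n * y (Suc n) = padic_residue x n * y n] (mod ?p ^ n)"
      using inv[of n] by (meson cong_scalar_right cong_sym cong_trans)
    then have "[y (Suc n) = y n] (mod ?p ^ n)" using cop[of n] False by (simp add: cong_mult_lcancel)
    then show ?thesis using range[of n] by (simp add: cong_def)
  qed (simp add: y_def)
  then have "padic_residue (Abs_padic_int y :: 'p padic_int) n = y n" for n
    using range by (subst Abs_padic_int_inverse) auto
  then have "padic_residue (x * Abs_padic_int y) n = padic_residue (1 :: 'p padic_int) n" for n
    using inv[of n] by (simp add: padic_residue_times one_padic_int.rep_eq cong_def)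
  then show ?thesis by (metis padic_int_eqI that)
qed

section \<open>The p-adic integers as a subring of the p-adic numbers\<close>

lemma padic_ints_iff: "x \<in> padic_ints \<longleftrightarrow> (\<exists>y. x = to_fract y)"
  by (auto simp: padic_ints_def to_fract_def)

lemma inverse_mem_padic_ints:
  assumes "padic_residue x 1 \<noteq> 0"
  shows "inverse (to_fract x) \<in> padic_ints"
proof -
  obtain y where "x * y = 1" using padic_int_unit[OF assms] .
  then have "to_fract x * to_fract y = 1" by (metis to_fract_mult to_fract_1)
  then have "inverse (to_fract x) = to_fract y" by (rule inverse_unique)
  then show ?thesis by (auto simp: padic_ints_iff)
qed

lemma to_fract_of_nat: "to_fract (of_nat k) = of_nat k"
  by (simp add: to_fract_def of_nat_fract)

lemma to_fract_power: "to_fract (x ^ k) = to_fract x ^ k"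
  by (induction k) simp_all

text \<open>The two arithmetic axioms are decided modulo p: a nonzero residue gives a unit, and
  Fermat's little theorem for the residue makes x^p - x divisible by p.\<close>

lemma p_local_subring_padic_ints:
  "p_local_subring (padic_ints :: 'p::prime_card padic set) CARD('p)"
proof
  show prime: "prime CARD('p)" by (rule prime_card)
  show "(1 :: 'p padic) \<in> padic_ints" unfolding padic_ints_iff by (metis to_fract_1)
  fix x y :: "'p padic" and m :: nat
  show "x - y \<in> padic_ints" if "x \<in> padic_ints" "y \<in> padic_ints"
    using that unfolding padic_ints_iff by (metis to_fract_diff)
  show "x * y \<in> padic_ints" if "x \<in> padic_ints" "y \<in> padic_ints"
    using that unfolding padic_ints_iff by (metis to_fract_mult)
  show "inverse (of_nat m) \<in> (padic_ints :: 'p padic set)" if "\<not> CARD('p) dvd m"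
  proof -
    have "\<not> int CARD('p) dvd int m" using that by (simp only: int_dvd_int_iff) simp
    then have "padic_residue (of_nat m :: 'p padic_int) 1 \<noteq> 0"
      by (simp add: padic_residue_of_nat dvd_eq_mod_eq_0)
    then have "inverse (to_fract (of_nat m :: 'p padic_int)) \<in> padic_ints"
      by (rule inverse_mem_padic_ints)
    then show ?thesis by (simp only: to_fract_of_nat)
  qed
  show "(x ^ CARD('p) - x) / of_nat CARD('p) \<in> padic_ints" if x: "x \<in> padic_ints"
  proof -
    obtain z where z: "x = to_fract z" using x by (auto simp: padic_ints_iff)
    define k where "k = nat (padic_residue z 1)"
    have k: "padic_residue z 1 = int k" using padic_residue[of z] by (auto simp: k_def)
    have "[k ^ CARD('p) = k] (mod CARD('p))"
    proof (cases "CARD('p) dvd k")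
      case True
      moreover have "CARD('p) dvd k ^ CARD('p)" using True prime by (meson dvd_trans dvd_power prime_gt_0_nat)
      ultimately show ?thesis by (simp add: cong_def dvd_eq_mod_eq_0)
    next
      case False
      have "[k * k ^ (CARD('p) - 1) = k * 1] (mod CARD('p))"
        by (intro cong_mult cong_refl fermat_theorem prime False)
      then show ?thesis using prime by (simp add: power_eq_if)
    qed
    then have "[int k ^ CARD('p) = int k] (mod int CARD('p))"
      unfolding of_nat_power[symmetric] cong_int_iff .
    then have "padic_residue (z ^ CARD('p) - z) 1 = 0"
      by (simp add: padic_residue_minus padic_residue_power k[simplified] cong_def mod_eq_dvd_iff mod_simps
          flip: dvd_eq_mod_eq_0)
    then obtain y where "z ^ CARD('p) - z = of_nat CARD('p) * y" by (rule padic_int_divisible_by_p)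
    then have "x ^ CARD('p) - x = of_nat CARD('p) * to_fract y"
      by (metis z to_fract_diff to_fract_power to_fract_mult to_fract_of_nat)
    then show ?thesis by (auto simp: padic_ints_iff)
  qed
qed

text \<open>Norm 1 means valuation 0, hence a nonzero residue modulo p.\<close>

lemma padic_norm_1_unit:
  fixes x :: "'p::prime_card padic"
  assumes "x \<in> padic_ints" "padic_norm x = 1"
  shows "inverse x \<in> padic_ints" "x \<noteq> 0"
proof -
  obtain z where z: "x = to_fract z" using assms(1) by (auto simp: padic_ints_iff)
  have "padic_int_norm (1 :: 'p padic_int) = 1"
    using padic_int_norm_mult[of "1 :: 'p padic_int" 1] padic_int_norm_eq_0_iff[of "1 :: 'p padic_int"] by simp
  then have norm: "padic_int_norm z = 1" using assms(2) by (simp add: z to_fract_def padic_norm_Fract)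
  then have "z \<noteq> 0" by (metis padic_int_norm_eq_0_iff zero_neq_one)
  then show "x \<noteq> 0" by (simp add: z)
  have "CARD('p) > 1" using prime_card[where 'a='p] by (rule prime_gt_1_nat)
  moreover have "real CARD('p) ^ padic_int_val z = 1" using norm \<open>z \<noteq> 0\<close>
    by (simp add: padic_int_norm_def power_one_over)
  ultimately have "padic_int_val z = 0" by (metis less_irrefl neq0_conv of_nat_1 of_nat_less_iff one_less_power)
  then have "padic_residue z 1 \<noteq> 0" using padic_residue_eq_0_iff_val[OF \<open>z \<noteq> 0\<close>, of 1] by simp
  then show "inverse x \<in> padic_ints" unfolding z by (rule inverse_mem_padic_ints)
qed

lemma padic_integral_fps_iff: "padic_integral_fps F \<longleftrightarrow> F \<in> fps_with_coeffs padic_ints"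
  by (simp add: padic_integral_fps_def fps_with_coeffs_def)

theorem theorem6p7:
  fixes p n :: nat
    and a :: "nat \<Rightarrow> 'p::prime_card padic fps"
    and f g :: "'p padic fps"
    and \<Phi> :: "'p padic fps mat"
  assumes "p = CARD('p)"
    and "n \<ge> 2"
    and "\<And>i. i < n \<Longrightarrow> padic_integral_fps (a i)"
    and "MUM n a"
    and "fps_nth f 0 = 1"
    and "fps_nth g 0 = 0"
    and "diff_op n a [:f:] = 0"
    and "diff_op n a (Polynomial.smult f log_z + [:g:]) = 0"
    and "p_integral_Frobenius_structure n a \<Phi>"
    and "padic_norm (fps_nth (\<Phi> $$ (0, 0)) 0) = 1"
  shows "padic_integral_fps (exp_quotient f g ^ p)"
proof -
  have carrier: "\<Phi> \<in> carrier_mat n n"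
    and \<Phi>: "\<And>i j. i < n \<Longrightarrow> j < n \<Longrightarrow> \<Phi> $$ (i, j) \<in> fps_with_coeffs padic_ints"
    and eq: "map_mat fps_XD \<Phi> = companion_mat n a * \<Phi>
       - of_nat CARD('p) \<cdot>\<^sub>m (\<Phi> * map_mat (\<lambda>F. F oo fps_X ^ CARD('p)) (companion_mat n a))"
    using assms(9) by (auto simp: p_integral_Frobenius_structure_def padic_integral_fps_iff)
  have comp: "companion_mat n a \<in> carrier_mat n n" by (simp add: companion_mat_def)
  have \<Phi>_eq: "fps_XD (\<Phi> $$ (i, j)) = (\<Sum>k<n. companion_mat n a $$ (i, k) * \<Phi> $$ (k, j))
      - of_nat p * (\<Sum>k<n. \<Phi> $$ (i, k) * (companion_mat n a $$ (k, j) oo fps_X ^ p))"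
    if "i < n" "j < n" for i j
    using arg_cong[OF eq, of "\<lambda>M. M $$ (i, j)"] that carrier comp assms(1)
    by (simp add: scalar_prod_def atLeast0LessThan)
  have unit: "inverse (fps_nth (\<Phi> $$ (0, 0)) 0) \<in> padic_ints" "fps_nth (\<Phi> $$ (0, 0)) 0 \<noteq> 0"
    using padic_norm_1_unit[OF _ assms(10)] fps_with_coeffsD[OF \<Phi>[of 0 0]] assms(2) by auto
  interpret p_local_subring "padic_ints :: 'p padic set" p
    unfolding assms(1) by (rule p_local_subring_padic_ints)
  interpret MUM_frobenius padic_ints p n a f g "\<lambda>i j. \<Phi> $$ (i, j)"
  proof
    show "fps_diff_op n a f = 0" and "log_part f g n + (\<Sum>i<n. a i * log_part f g i) = 0"
      using diff_op_log_solution[OF assms(8)] by simp_all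
  qed (use assms(2-6) \<Phi> \<Phi>_eq unit in \<open>auto simp: padic_integral_fps_iff\<close>)
  \<comment> \<open>The prefactor z of \<open>exp_quotient\<close> contributes only z^p, so
    integrality rests on the exponential factor.\<close>
  have "exp_quotient f g ^ p = fps_X ^ p * (fps_exp 1 oo (g / f)) ^ p"
    by (simp add: exp_quotient_def power_mult_distrib)
  also have "\<dots> \<in> RS"
    by (intro RS_mult exp_power_mem) (auto intro!: fps_with_coeffsI one_mem zero_mem)
  finally show ?thesis by (simp only: padic_integral_fps_iff)
qed

end
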